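(* Suppose that $(K,v)$ is a henselian valued field and let $[\Phi_0,\dots,\Phi_r,\Phi_{r+1}=\{F\}]$ be an Okutsu frame of some monic irreducible $F\in K[x]$ of degree $>1$. Then the set $\Phi_0\cup\cdots\cup\Phi_r\cup\{F\}$ is a complete set of abstract key polynomials for $v_F$.
   Context: **Valuations.** $\Gamma=v(K^* )$, $\Gamma_{\mathbb{Q}}=\Gamma\otimes\mathbb{Q}$; $v$ also denotes its unique extension to an algebraic closure $\overline{K}$. For $F\in K[x]$ monic irreducible, $v_F(f)=v(f(\theta))$ for $f\in K[x]$, with $\theta\in\overline K$ any root of $F$; it is a valuation on $K[x]$ with support $v_F^{-1}(\infty)=FK[x]$. **Key polynomials.** Let $\mu$ be a valuation on $K[x]$ extending $v$, possibly with nonzero support. For $\alpha\in\Gamma_\mu$ (the value group) let $\mathcal{P}_\alpha=\{g\mid\mu(g)\ge\alpha\}\supset\mathcal{P}_\alpha^+=\{g\mid\mu(g)>\alpha\}$, $\mathcal{G}_\mu=\bigoplus_\alpha\mathcal{P}_\alpha/\mathcal{P}_\alpha^+$; $\mathrm{in}_\mu g$ is the class of $g$ in $\mathcal{P}_{\mu(g)}/\mathcal{P}^+_{\mu(g)}$ if $\mu(g)<\infty$ and $0$ otherwise; $h\mid_\mu g$ means $\mathrm{in}_\mu h\mid\mathrm{in}_\mu g$ in $\mathcal{G}_\mu$. A (Mac Lane–Vaquié) key polynomial for $\mu$ is a monic $\phi$ such that $\mathrm{in}_\mu\phi$ generates a nonzero prime ideal and $\phi\nmid_\mu f$ for all nonzero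 $f$ with $\deg f<\deg\phi$. For $g\in K[x]\setminus K$, the truncation $\mu_g$ sends $f=\sum_s a_sg^s$ ($\deg a_s<\deg g$) to $\min_s\mu(a_sg^s)$ (in general not a valuation). **Abstract key polynomials.** For a valuation $\nu$ on $K[x]$ with nontrivial support, a monic $Q\in K[x]\setminus K$ is an abstract key polynomial for $\nu$ if and only if either $\mathrm{supp}(\nu)=QK[x]$, or the truncation $\nu_Q$ is a valuation and $Q$ is a Mac Lane–Vaquié key polynomial of minimal degree for $\nu_Q$. (This known characterization may be taken as the definition here.) A set $\Psi$ of abstract key polynomials for $\nu$ is complete if for every non-constant $g\in K[x]$ there is $Q\in\Psi$ with $\deg(Q)\le\deg(g)$ and $\nu_Q(g)=\nu(g)$. **Okutsu frames.** Let $n=\deg F>1$. For non-constant $g$ put $\mathrm{wt}(g)=v_F(g)/\deg(g)$. For $1<m\le n$ let $W_m=\{\mathrm{wt}(g)\mid g\in K[x]\text{ monic},\ 0<\deg g<m\}$. An Okutsu frame of $F$ is a list $[\Phi_0,\dots,\Phi_r,\Phi_{r+1}=\{F\}]$ of nonempty sets of monic irreducible polynomials such that all polynomials in $\Phi_\ell$ have the same degree $m_\ell$, $1=m_0<m_1<\cdots<m_{r+1}=n$, and for every $0\le\ell\le r$ and every monic $g$ with $0<\deg g<m_{\ell+1}$ there is $\phi\in\Phi_\ell$ with $\mathrm{wt}(g)\le\mathrm{wt}(\phi)$. Okutsu frames are always assumed to satisfy moreover, for $0\le\ell\le r$: (OF1) $\#\Phi_\ell=1$ whenever $\max(W_{m_{\ell+1}})$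 exists; (OF2) if $\max(W_{m_{\ell+1}})$ does not exist, $\Phi_\ell$ is totally ordered by $\phi<\phi'\iff v_F(\phi)<v_F(\phi')$ (distinct elements have distinct $v_F$-values); (OF3) $\mathrm{wt}(\phi)<\mathrm{wt}(\varphi)$ for all $\phi\in\Phi_\ell$, $\varphi\in\Phi_{\ell+1}$. *)

theory Defs
  imports
    "HOL-Algebra.Algebraic_Closure_Type"
    "HOL-Algebra.Ideal"
    "HOL-Algebra.Divisibility"
    "HOL-Library.Lattice_Constructions"
    "HOL-Library.Set_Algebras"
begin

hide_const (open) Polynomials.degree Polynomials.lead_coeff Divisibility.irreducible
  flat_complete_lattice.Value flat_complete_lattice.Top

text \<open>
  \<open>'g div_hull\<close> is the divisible hull \<open>'g \<otimes> \<rat>\<close> of the ordered abelian group \<open>'g\<close>; the pair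
  \<open>(x, m)\<close> with \<open>m > 0\<close> represents \<open>x \<otimes> 1/m\<close>.
\<close>

definition nat_mult :: "nat \<Rightarrow> 'g::linordered_ab_group_add \<Rightarrow> 'g" where
  "nat_mult n x = (\<Sum>i<n. x)"

lemma nat_mult_0 [simp]: "nat_mult 0 x = 0"
  by (simp add: nat_mult_def)

lemma nat_mult_Suc: "nat_mult (Suc n) x = x + nat_mult n x"
  by (simp add: nat_mult_def add.commute)

lemma nat_mult_1 [simp]: "nat_mult (Suc 0) x = x"
  by (simp add: nat_mult_Suc)

lemma nat_mult_zero [simp]: "nat_mult n 0 = 0"
  by (simp add: nat_mult_def)

lemma nat_mult_add: "nat_mult n (x + y) = nat_mult n x + nat_mult n y"
  by (simp add: nat_mult_def sum.distrib)

lemma nat_mult_minus: "nat_mult n (- x) = - nat_mult n x"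
  by (simp add: nat_mult_def sum_negf)

lemma nat_mult_add_left: "nat_mult (m + n) x = nat_mult m x + nat_mult n x"
  by (induction m) (simp_all add: nat_mult_Suc add.assoc)

lemma nat_mult_assoc: "nat_mult m (nat_mult n x) = nat_mult (m * n) x"
  by (induction m) (simp_all add: nat_mult_Suc nat_mult_add_left)

lemma nat_mult_left_commute: "nat_mult m (nat_mult n x) = nat_mult n (nat_mult m x)"
  by (simp add: nat_mult_assoc mult.commute)

lemma nat_mult_less: "0 < n \<Longrightarrow> x < y \<Longrightarrow> nat_mult n x < nat_mult n y"
  unfolding nat_mult_def by (rule sum_strict_mono) auto

lemma nat_mult_le_iff: "0 < n \<Longrightarrow> nat_mult n x \<le> nat_mult n y \<longleftrightarrow> x \<le> y"
  by (metis nat_mult_less not_le order_le_less)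

lemma nat_mult_eq_iff: "0 < n \<Longrightarrow> nat_mult n x = nat_mult n y \<longleftrightarrow> x = y"
  by (metis nat_mult_less less_irrefl linorder_neqE)

definition hull_rel :: "'g::linordered_ab_group_add \<times> nat \<Rightarrow> 'g \<times> nat \<Rightarrow> bool" where
  "hull_rel p q \<longleftrightarrow> 0 < snd p \<and> 0 < snd q \<and> nat_mult (snd q) (fst p) = nat_mult (snd p) (fst q)"

lemma part_equivp_hull_rel:
  "part_equivp (hull_rel :: 'g::linordered_ab_group_add \<times> nat \<Rightarrow> _)"
proof (rule part_equivpI)
  show "\<exists>p :: 'g \<times> nat. hull_rel p p"
    by (rule exI [of _ "(0, 1)"]) (simp add: hull_rel_def)
  show "symp (hull_rel :: 'g \<times> nat \<Rightarrow> _)"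
    by (auto simp: symp_def hull_rel_def)
  show "transp (hull_rel :: 'g \<times> nat \<Rightarrow> _)"
  proof (rule transpI)
    fix p q r :: "'g \<times> nat"
    assume pq: "hull_rel p q" and qr: "hull_rel q r"
    have "nat_mult (snd q) (nat_mult (snd r) (fst p)) = nat_mult (snd r) (nat_mult (snd p) (fst q))"
      using pq by (metis hull_rel_def nat_mult_left_commute)
    also have "\<dots> = nat_mult (snd q) (nat_mult (snd p) (fst r))"
      using qr by (metis hull_rel_def nat_mult_left_commute)
    finally show "hull_rel p r"
      using pq qr by (simp add: hull_rel_def nat_mult_eq_iff)
  qed
qed

quotient_type (overloaded) 'g div_hull = "'g::linordered_ab_group_add \<times> nat" / partial: hull_rel
  by (rule part_equivp_hull_rel)

instantiation div_hull :: (linordered_ab_group_add) linordered_ab_group_add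
begin

lift_definition zero_div_hull :: "'a div_hull" is "(0, 1)"
  by (simp add: hull_rel_def)

lift_definition plus_div_hull :: "'a div_hull \<Rightarrow> 'a div_hull \<Rightarrow> 'a div_hull"
  is "\<lambda>p q. (nat_mult (snd q) (fst p) + nat_mult (snd p) (fst q), snd p * snd q)"
proof -
  fix p p' q q' :: "'a \<times> nat"
  assume *: "hull_rel p p'" "hull_rel q q'"
  have "nat_mult (snd p' * snd q') (nat_mult (snd q) (fst p)) =
      nat_mult (snd q' * snd q) (nat_mult (snd p') (fst p))"
    by (simp add: nat_mult_assoc mult_ac)
  also have "\<dots> = nat_mult (snd q' * snd q) (nat_mult (snd p) (fst p'))"
    using * by (simp add: hull_rel_def)
  finally have 1: "nat_mult (snd p' * snd q') (nat_mult (snd q) (fst p)) =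
      nat_mult (snd p * snd q) (nat_mult (snd q') (fst p'))"
    by (simp add: nat_mult_assoc mult_ac)
  have "nat_mult (snd p' * snd q') (nat_mult (snd p) (fst q)) =
      nat_mult (snd p' * snd p) (nat_mult (snd q') (fst q))"
    by (simp add: nat_mult_assoc mult_ac)
  also have "\<dots> = nat_mult (snd p' * snd p) (nat_mult (snd q) (fst q'))"
    using * by (simp add: hull_rel_def)
  finally have 2: "nat_mult (snd p' * snd q') (nat_mult (snd p) (fst q)) =
      nat_mult (snd p * snd q) (nat_mult (snd p') (fst q'))"
    by (simp add: nat_mult_assoc mult_ac)
  show "hull_rel (nat_mult (snd q) (fst p) + nat_mult (snd p) (fst q), snd p * snd q)
      (nat_mult (snd q') (fst p') + nat_mult (snd p') (fst q'), snd p' * snd q')"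
    using * 1 2 by (simp add: hull_rel_def nat_mult_add)
qed

lift_definition uminus_div_hull :: "'a div_hull \<Rightarrow> 'a div_hull" is "\<lambda>p. (- fst p, snd p)"
  by (simp add: hull_rel_def nat_mult_minus)

definition minus_div_hull :: "'a div_hull \<Rightarrow> 'a div_hull \<Rightarrow> 'a div_hull" where
  "minus_div_hull x y = x + - y"

lift_definition less_eq_div_hull :: "'a div_hull \<Rightarrow> 'a div_hull \<Rightarrow> bool"
  is "\<lambda>p q. nat_mult (snd q) (fst p) \<le> nat_mult (snd p) (fst q)"
proof -
  fix p p' q q' :: "'a \<times> nat"
  assume *: "hull_rel p p'" "hull_rel q q'"
  have "nat_mult (snd q) (fst p) \<le> nat_mult (snd p) (fst q) \<longleftrightarrow>
      nat_mult (snd p' * snd q') (nat_mult (snd q) (fst p)) \<le>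
      nat_mult (snd p' * snd q') (nat_mult (snd p) (fst q))"
    using * by (simp add: nat_mult_le_iff hull_rel_def)
  also have "nat_mult (snd p' * snd q') (nat_mult (snd q) (fst p)) =
      nat_mult (snd q' * snd q) (nat_mult (snd p') (fst p))"
    by (simp add: nat_mult_assoc mult_ac)
  also have "\<dots> = nat_mult (snd p * snd q) (nat_mult (snd q') (fst p'))"
    using * by (simp add: hull_rel_def nat_mult_assoc mult_ac)
  also have "nat_mult (snd p' * snd q') (nat_mult (snd p) (fst q)) =
      nat_mult (snd p' * snd p) (nat_mult (snd q') (fst q))"
    by (simp add: nat_mult_assoc mult_ac)
  also have "\<dots> = nat_mult (snd p * snd q) (nat_mult (snd p') (fst q'))"
    using * by (simp add: hull_rel_def nat_mult_assoc mult_ac)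
  finally show "(nat_mult (snd q) (fst p) \<le> nat_mult (snd p) (fst q)) =
      (nat_mult (snd q') (fst p') \<le> nat_mult (snd p') (fst q'))"
    using * by (simp add: nat_mult_le_iff hull_rel_def)
qed

definition less_div_hull :: "'a div_hull \<Rightarrow> 'a div_hull \<Rightarrow> bool" where
  "less_div_hull x y \<longleftrightarrow> x \<le> y \<and> \<not> y \<le> x"

instance
proof
  fix x y z :: "'a div_hull"
  show "x + y + z = x + (y + z)"
    by transfer (simp add: hull_rel_def nat_mult_add nat_mult_assoc mult_ac add_ac)
  show "x + y = y + x"
    by transfer (simp add: hull_rel_def mult_ac add_ac)
  show "0 + x = x"
    by transfer (simp add: hull_rel_def)
  show "- x + x = 0"
    by transfer (simp add: hull_rel_def nat_mult_minus)
  show "x - y = x + - y"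
    by (rule minus_div_hull_def)
  show "x < y \<longleftrightarrow> x \<le> y \<and> \<not> y \<le> x"
    by (rule less_div_hull_def)
  show "x \<le> x"
    by transfer simp
  show "x \<le> y \<Longrightarrow> y \<le> x \<Longrightarrow> x = y"
    by transfer (simp add: hull_rel_def)
  show "x \<le> y \<or> y \<le> x"
    by transfer auto
  show "x \<le> z" if "x \<le> y" "y \<le> z"
    using that
  proof transfer
    fix p q r :: "'a \<times> nat"
    assume *: "hull_rel p p" "hull_rel q q" "hull_rel r r"
      and pq: "nat_mult (snd q) (fst p) \<le> nat_mult (snd p) (fst q)"
      and qr: "nat_mult (snd r) (fst q) \<le> nat_mult (snd q) (fst r)"
    have "nat_mult (snd q) (nat_mult (snd r) (fst p)) = nat_mult (snd r) (nat_mult (snd q) (fst p))"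
      by (rule nat_mult_left_commute)
    also have "\<dots> \<le> nat_mult (snd r) (nat_mult (snd p) (fst q))"
      using * pq by (simp add: nat_mult_le_iff hull_rel_def)
    also have "\<dots> = nat_mult (snd p) (nat_mult (snd r) (fst q))"
      by (rule nat_mult_left_commute)
    also have "\<dots> \<le> nat_mult (snd p) (nat_mult (snd q) (fst r))"
      using * qr by (simp add: nat_mult_le_iff hull_rel_def)
    also have "\<dots> = nat_mult (snd q) (nat_mult (snd p) (fst r))"
      by (rule nat_mult_left_commute)
    finally show "nat_mult (snd r) (fst p) \<le> nat_mult (snd p) (fst r)"
      using * by (simp add: nat_mult_le_iff hull_rel_def)
  qed
  show "z + x \<le> z + y" if "x \<le> y"
    using that
  proof transfer
    fix p q r :: "'a \<times> nat"
    assume *: "hull_rel p p" "hull_rel q q" "hull_rel r r"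
      and pq: "nat_mult (snd q) (fst p) \<le> nat_mult (snd p) (fst q)"
    have "nat_mult (snd r * snd q) (nat_mult (snd r) (fst p)) =
        nat_mult (snd r * snd r) (nat_mult (snd q) (fst p))"
      by (simp add: nat_mult_assoc mult_ac)
    also have "\<dots> \<le> nat_mult (snd r * snd r) (nat_mult (snd p) (fst q))"
      using * pq by (simp add: nat_mult_le_iff hull_rel_def)
    also have "\<dots> = nat_mult (snd r * snd p) (nat_mult (snd r) (fst q))"
      by (simp add: nat_mult_assoc mult_ac)
    finally show "nat_mult (snd (nat_mult (snd q) (fst r) + nat_mult (snd r) (fst q), snd r * snd q))
          (fst (nat_mult (snd p) (fst r) + nat_mult (snd r) (fst p), snd r * snd p)) \<le>
        nat_mult (snd (nat_mult (snd p) (fst r) + nat_mult (snd r) (fst p), snd r * snd p))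
          (fst (nat_mult (snd q) (fst r) + nat_mult (snd r) (fst q), snd r * snd q))"
      by (simp add: nat_mult_add nat_mult_assoc mult_ac)
  qed
qed

end

lift_definition to_hull :: "'g::linordered_ab_group_add \<Rightarrow> 'g div_hull" is "\<lambda>x. (x, 1)"
  by (simp add: hull_rel_def)

lift_definition hull_div :: "'g::linordered_ab_group_add div_hull \<Rightarrow> nat \<Rightarrow> 'g div_hull"
  is "\<lambda>p n. if n = 0 then (0, 1) else (fst p, n * snd p)"
  by (auto simp: hull_rel_def simp flip: nat_mult_assoc)

text \<open>
  Values live in \<open>'g top\<close>, that is \<open>'g \<union> {\<infinity>}\<close> with \<open>\<infinity> = Top\<close>.
\<close>

instantiation top :: (comm_monoid_add) comm_monoid_add
begin

definition zero_top :: "'a top" where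
  "zero_top = Value 0"

definition plus_top :: "'a top \<Rightarrow> 'a top \<Rightarrow> 'a top" where
  "plus_top x y = (case x of Top \<Rightarrow> Top | Value a \<Rightarrow> (case y of Top \<Rightarrow> Top | Value b \<Rightarrow> Value (a + b)))"

instance
  by standard (auto simp: zero_top_def plus_top_def add_ac split: top.splits)

end

text \<open>
  A valuation on a commutative ring may have nonzero support. On a field, the first and third
  conditions force the support to be zero.
\<close>

definition valuation :: "('r::comm_ring_1 \<Rightarrow> 'g::linordered_ab_group_add top) \<Rightarrow> bool" where
  "valuation v \<longleftrightarrow> v 1 = 0 \<and> v 0 = Top \<and> (\<forall>x y. v (x * y) = v x + v y) \<and>
     (\<forall>x y. min (v x) (v y) \<le> v (x + y))"

definition support :: "('r::comm_ring_1 \<Rightarrow> 'g::linordered_ab_group_add top) \<Rightarrow> 'r set" where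
  "support v = {x. v x = Top}"

text \<open>
  The value group of an extension of \<open>v\<close> to the algebraic closure is torsion over that of \<open>v\<close>,
  hence embeds uniquely in the divisible hull: extensions up to equivalence are the same as
  extensions with values in the hull.
\<close>

definition extends_to_closure ::
    "('a::field \<Rightarrow> 'g::linordered_ab_group_add top) \<Rightarrow> ('a alg_closure \<Rightarrow> 'g div_hull top) \<Rightarrow> bool" where
  "extends_to_closure v w \<longleftrightarrow> valuation w \<and> (\<forall>a. w (to_ac a) = map_top to_hull (v a))"

definition henselian :: "('a::field \<Rightarrow> 'g::linordered_ab_group_add top) \<Rightarrow> bool" where
  "henselian v \<longleftrightarrow> valuation v \<and> (\<exists>!w. extends_to_closure v w)"

definition closure_valuation ::
    "('a::field \<Rightarrow> 'g::linordered_ab_group_add top) \<Rightarrow> 'a alg_closure \<Rightarrow> 'g div_hull top" where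
  "closure_valuation v = (THE w. extends_to_closure v w)"

text \<open>\<open>root_valuation v \<theta>\<close> is \<open>v\<^sub>F\<close> when \<open>\<theta>\<close> is a root of the monic irreducible polynomial \<open>F\<close>.\<close>

definition root_valuation ::
    "('a::field \<Rightarrow> 'g::linordered_ab_group_add top) \<Rightarrow> 'a alg_closure \<Rightarrow> 'a poly \<Rightarrow> 'g div_hull top" where
  "root_valuation v \<theta> f = closure_valuation v (poly (map_poly to_ac f) \<theta>)"

definition monic :: "'a::field poly \<Rightarrow> bool" where
  "monic f \<longleftrightarrow> lead_coeff f = 1"

definition P_ge :: "('r::comm_ring_1 \<Rightarrow> 'h::linordered_ab_group_add top) \<Rightarrow> 'h \<Rightarrow> 'r set" where
  "P_ge \<mu> \<alpha> = {g. Value \<alpha> \<le> \<mu> g}"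

definition P_gt :: "('r::comm_ring_1 \<Rightarrow> 'h::linordered_ab_group_add top) \<Rightarrow> 'h \<Rightarrow> 'r set" where
  "P_gt \<mu> \<alpha> = {g. Value \<alpha> < \<mu> g}"

definition initial_form ::
    "('r::comm_ring_1 \<Rightarrow> 'h::linordered_ab_group_add top) \<Rightarrow> 'r \<Rightarrow> 'h \<Rightarrow> 'r set" where
  "initial_form \<mu> g =
     (\<lambda>\<beta>. if \<mu> g = Value \<beta> then g +o P_gt \<mu> \<beta> else P_gt \<mu> \<beta>)"

text \<open>
  The direct sum of the quotients \<open>P_ge \<mu> \<alpha> / P_gt \<mu> \<alpha>\<close>: an element assigns a coset to every
  degree, almost all of them zero. The index \<open>\<alpha>\<close> ranges over the ambient group \<open>'h\<close> and not only
  over the value group of \<open>\<mu>\<close>; for every other \<open>\<alpha>\<close> the two subgroups coincide, so this adds only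
  zero summands. Sums and products of sets are elementwise.
\<close>

definition graded_algebra ::
    "('r::comm_ring_1 \<Rightarrow> 'h::linordered_ab_group_add top) \<Rightarrow> ('h \<Rightarrow> 'r set) ring" where
  "graded_algebra \<mu> =
    \<lparr>carrier = {u. (\<forall>\<alpha>. \<exists>g\<in>P_ge \<mu> \<alpha>. u \<alpha> = g +o P_gt \<mu> \<alpha>) \<and> finite {\<alpha>. u \<alpha> \<noteq> P_gt \<mu> \<alpha>}},
     monoid.mult = (\<lambda>u w \<gamma>. P_gt \<mu> \<gamma> + (\<Sum>\<alpha> | u \<alpha> \<noteq> P_gt \<mu> \<alpha>. u \<alpha> * w (\<gamma> - \<alpha>))),
     one = initial_form \<mu> 1,
     ring.zero = P_gt \<mu>,
     add = (\<lambda>u w \<alpha>. u \<alpha> + w \<alpha>)\<rparr>"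

definition graded_dvd :: "('r::comm_ring_1 \<Rightarrow> 'h::linordered_ab_group_add top) \<Rightarrow> 'r \<Rightarrow> 'r \<Rightarrow> bool" where
  "graded_dvd \<mu> h g \<longleftrightarrow> initial_form \<mu> h divides\<^bsub>graded_algebra \<mu>\<^esub> initial_form \<mu> g"

definition key_polynomial ::
    "('a::field poly \<Rightarrow> 'h::linordered_ab_group_add top) \<Rightarrow> 'a poly \<Rightarrow> bool" where
  "key_polynomial \<mu> \<phi> \<longleftrightarrow>
     monic \<phi> \<and>
     primeideal (PIdl\<^bsub>graded_algebra \<mu>\<^esub> (initial_form \<mu> \<phi>)) (graded_algebra \<mu>) \<and>
     PIdl\<^bsub>graded_algebra \<mu>\<^esub> (initial_form \<mu> \<phi>) \<noteq> {\<zero>\<^bsub>graded_algebra \<mu>\<^esub>} \<and>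
     (\<forall>f. f \<noteq> 0 \<and> degree f < degree \<phi> \<longrightarrow> \<not> graded_dvd \<mu> \<phi> f)"

definition expansion :: "'a::field poly \<Rightarrow> 'a poly \<Rightarrow> 'a poly poly" where
  "expansion g f = (THE a. (\<forall>s. degree (coeff a s) < degree g) \<and> poly a g = f)"

definition truncation ::
    "('a::field poly \<Rightarrow> 'h::linordered_ab_group_add top) \<Rightarrow> 'a poly \<Rightarrow> 'a poly \<Rightarrow> 'h top" where
  "truncation \<mu> g f =
     Min ((\<lambda>s. \<mu> (coeff (expansion g f) s * g ^ s)) ` {..degree (expansion g f)})"

definition abstract_key_polynomial ::
    "('a::field poly \<Rightarrow> 'h::linordered_ab_group_add top) \<Rightarrow> 'a poly \<Rightarrow> bool" where
  "abstract_key_polynomial \<nu> Q \<longleftrightarrow>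
     monic Q \<and> 0 < degree Q \<and>
     (support \<nu> = {f. Q dvd f} \<or>
      valuation (truncation \<nu> Q) \<and> key_polynomial (truncation \<nu> Q) Q \<and>
      (\<forall>\<phi>. key_polynomial (truncation \<nu> Q) \<phi> \<longrightarrow> degree Q \<le> degree \<phi>))"

definition complete_set ::
    "('a::field poly \<Rightarrow> 'h::linordered_ab_group_add top) \<Rightarrow> 'a poly set \<Rightarrow> bool" where
  "complete_set \<nu> \<Psi> \<longleftrightarrow>
     (\<forall>Q\<in>\<Psi>. abstract_key_polynomial \<nu> Q) \<and>
     (\<forall>g. 0 < degree g \<longrightarrow> (\<exists>Q\<in>\<Psi>. degree Q \<le> degree g \<and> truncation \<nu> Q g = \<nu> g))"

definition wt ::
    "('a::field poly \<Rightarrow> 'g::linordered_ab_group_add div_hull top) \<Rightarrow> 'a poly \<Rightarrow> 'g div_hull top" where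
  "wt \<nu> g = map_top (\<lambda>\<gamma>. hull_div \<gamma> (degree g)) (\<nu> g)"

definition weights ::
    "('a::field poly \<Rightarrow> 'g::linordered_ab_group_add div_hull top) \<Rightarrow> nat \<Rightarrow> 'g div_hull top set" where
  "weights \<nu> m = {wt \<nu> g | g. monic g \<and> 0 < degree g \<and> degree g < m}"

definition has_max :: "'b::linorder set \<Rightarrow> bool" where
  "has_max W \<longleftrightarrow> (\<exists>w\<in>W. \<forall>w'\<in>W. w' \<le> w)"

text \<open>
  The list is \<open>\<Phi> ! 0, \<dots>, \<Phi> ! (r + 1)\<close>. The last three clauses are (OF1), (OF2) and (OF3). In (OF2)
  only the injectivity of \<open>\<nu>\<close> has to be required: values are always linearly ordered.
\<close>

definition okutsu_frame ::
    "('a::field poly \<Rightarrow> 'g::linordered_ab_group_add div_hull top) \<Rightarrow> 'a poly \<Rightarrow> 'a poly set list \<Rightarrow> bool" where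
  "okutsu_frame \<nu> F \<Phi> \<longleftrightarrow> (\<exists>r m.
     length \<Phi> = r + 2 \<and> \<Phi> ! (r + 1) = {F} \<and>
     (\<forall>l\<le>r + 1. \<Phi> ! l \<noteq> {}) \<and>
     (\<forall>l\<le>r + 1. \<forall>\<phi>\<in>\<Phi> ! l. monic \<phi> \<and> irreducible \<phi> \<and> degree \<phi> = m l) \<and>
     m 0 = 1 \<and> (\<forall>l\<le>r. m l < m (l + 1)) \<and> m (r + 1) = degree F \<and>
     (\<forall>l\<le>r. \<forall>g. monic g \<and> 0 < degree g \<and> degree g < m (l + 1) \<longrightarrow>
        (\<exists>\<phi>\<in>\<Phi> ! l. wt \<nu> g \<le> wt \<nu> \<phi>)) \<and>
     (\<forall>l\<le>r. has_max (weights \<nu> (m (l + 1))) \<longrightarrow> card (\<Phi> ! l) = 1) \<and>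
     (\<forall>l\<le>r. \<not> has_max (weights \<nu> (m (l + 1))) \<longrightarrow> inj_on \<nu> (\<Phi> ! l)) \<and>
     (\<forall>l\<le>r. \<forall>\<phi>\<in>\<Phi> ! l. \<forall>\<psi>\<in>\<Phi> ! (l + 1). wt \<nu> \<phi> < wt \<nu> \<psi>))"

end

theory Submission
  imports Defs "HOL-Library.Poly_Mapping"
begin

text \<open>
  Let \<open>w\<close> be the extension of \<open>v\<close> to the algebraic closure. By uniqueness \<open>w\<close> is invariant under
  automorphisms over \<open>K\<close>, so the weight of an irreducible \<open>g\<close> with root \<open>\<beta>\<close> is the average of
  \<open>w (\<theta> - \<sigma> \<beta>)\<close> over the conjugates of \<open>\<beta>\<close>. Let \<open>Q\<close> be a member of the frame of degree less than
  \<open>deg F\<close>, let \<open>\<alpha>\<close> be a root of \<open>Q\<close> closest to \<open>\<theta>\<close>, and let \<open>\<delta> = w (\<theta> - \<alpha>)\<close>. If \<open>w (\<theta> - \<beta>) \<ge> \<delta>\<close>,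
  then \<open>w (\<theta> - \<sigma> \<beta>) \<ge> w (\<theta> - \<sigma> \<alpha>)\<close> for all \<open>\<sigma>\<close>, hence \<open>wt g \<ge> wt Q\<close>, with strict inequality if
  \<open>w (\<theta> - \<beta>) > \<delta>\<close>. The frame thus says that no root of a polynomial of degree less than \<open>deg Q\<close> is as
  close to \<open>\<theta>\<close> as \<open>\<alpha>\<close>. Consequently the restriction to \<open>K[x]\<close> of the Gauss valuation centred at \<open>\<alpha>\<close>
  with radius \<open>\<delta>\<close> is the truncation of \<open>v\<^sub>F\<close> at \<open>Q\<close>, and it agrees with \<open>v\<^sub>F\<close> on every polynomial
  without roots closer to \<open>\<theta>\<close> than \<open>\<alpha>\<close>. Completeness follows by choosing, among the members of the
  right degree, a \<open>Q\<close> whose weight dominates those of all irreducible factors of the given polynomial.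
  In the graded algebra of the truncation, the initial form of \<open>Q\<close> generates the kernel of the
  map to the graded algebra of evaluation at \<open>\<alpha>\<close>, and all nonzero polynomials of smaller
  degree have invertible initial forms.
\<close>

subsection \<open>Valuations\<close>

instance top :: (ordered_comm_monoid_add) ordered_comm_monoid_add
  by standard (auto simp: plus_top_def split: top.splits intro: add_left_mono)

lemma Value_add [simp]: "Value a + Value b = Value (a + b)"
  and Top_add [simp]: "Top + x = Top"
  and add_Top [simp]: "x + Top = Top"
  by (auto simp: plus_top_def split: top.splits)

lemma add_eq_Top_iff: "x + y = Top \<longleftrightarrow> x = Top \<or> y = Top"
  by (cases x; cases y) auto

lemma not_Top_iff_less: "x \<noteq> Top \<longleftrightarrow> x < (Top :: 'h::linorder top)"
  by (cases x) auto

lemma top_add_strict_mono1: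
  fixes x y z :: "'h::linordered_ab_group_add top"
  assumes "x < y" "z \<noteq> Top"
  shows "x + z < y + z"
  using assms by (cases x; cases y; cases z) auto

lemma top_add_le_less_mono:
  fixes x y z :: "'h::linordered_ab_group_add top"
  assumes "x \<le> y" "x \<noteq> Top" "z < u"
  shows "x + z < y + u"
  using assms by (cases x; cases y; cases z; cases u) (auto intro: add_le_less_mono)

locale valued_ring =
  fixes v :: "'r::comm_ring_1 \<Rightarrow> 'h::linordered_ab_group_add top"
  assumes val: "valuation v"
begin

lemma v_0 [simp]: "v 0 = Top"
  and v_1 [simp]: "v 1 = 0"
  and v_mult: "v (x * y) = v x + v y"
  and v_add: "min (v x) (v y) \<le> v (x + y)"
  using val by (auto simp: valuation_def)

lemma v_uminus [simp]: "v (- x) = v x"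
proof -
  have "v (-1) + v (-1) = 0"
    by (simp flip: v_mult)
  then have "v (-1) = 0"
    by (cases "v (-1)") (auto simp: zero_top_def)
  then show ?thesis
    using v_mult[of "-1" x] by simp
qed

lemma v_diff: "min (v x) (v y) \<le> v (x - y)"
  using v_add[of x "- y"] by simp

lemma v_diff_commute: "v (x - y) = v (y - x)"
  using v_uminus[of "x - y"] by simp

lemma v_add_ge: "a \<le> v x \<Longrightarrow> a \<le> v y \<Longrightarrow> a \<le> v (x + y)"
  using v_add[of x y] by (auto simp: min_def split: if_splits)

lemma v_diff_ge: "a \<le> v x \<Longrightarrow> a \<le> v y \<Longrightarrow> a \<le> v (x - y)"
  using v_diff[of x y] by (auto simp: min_def split: if_splits)

lemma v_add_gt: "a < v x \<Longrightarrow> a < v y \<Longrightarrow> a < v (x + y)"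
  using v_add[of x y] by (auto simp: min_def split: if_splits)

lemma v_diff_gt: "a < v x \<Longrightarrow> a < v y \<Longrightarrow> a < v (x - y)"
  using v_diff[of x y] by (auto simp: min_def split: if_splits)

lemma v_add_eq: "v x < v y \<Longrightarrow> v (x + y) = v x"
  using v_add[of x y] v_diff[of "x + y" y] by (auto simp: min_def split: if_splits)

lemma v_diff_eq: "v x < v y \<Longrightarrow> v (x - y) = v x"
  using v_add_eq[of x "- y"] by simp

lemma v_eqI: "v x < v (x - y) \<Longrightarrow> v y = v x"
  using v_diff_eq[of x "x - y"] by simp

lemma v_sum_ge: "(\<And>i. i \<in> A \<Longrightarrow> a \<le> v (f i)) \<Longrightarrow> a \<le> v (sum f A)"
  by (induction A rule: infinite_finite_induct) (auto intro!: v_add_ge)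

lemma v_sum_gt:
  assumes "a \<noteq> Top" "\<And>i. i \<in> A \<Longrightarrow> a < v (f i)"
  shows "a < v (sum f A)"
  using assms(2)
  by (induction A rule: infinite_finite_induct) (use assms(1) in \<open>auto intro!: v_add_gt simp: not_Top_iff_less\<close>)

lemma v_prod_mset: "v (prod_mset A) = (\<Sum>x\<in>#A. v x)"
  by (induction A) (auto simp: v_mult)

end

lemma (in valued_ring) v_unit_not_Top:
  "x * y = 1 \<Longrightarrow> v x \<noteq> Top"
  using v_mult[of x y] by (auto simp: zero_top_def)

lemma valuation_eq_Top_iff:
  fixes v :: "'k::field \<Rightarrow> 'h::linordered_ab_group_add top"
  assumes "valuation v"
  shows "v x = Top \<longleftrightarrow> x = 0"
proof -
  interpret valued_ring v by unfold_locales fact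
  show ?thesis
    using v_unit_not_Top[of x "inverse x"] by (cases "x = 0") auto
qed

subsection \<open>Ring homomorphisms and polynomials\<close>

text \<open>Homomorphisms are bare functions here, so that \<open>to_ac\<close>, its coefficientwise
  extension to polynomials, evaluation at a point and automorphisms of the closure are all
  instances.\<close>

locale ring_hom_fun =
  fixes h :: "'r::comm_ring_1 \<Rightarrow> 's::comm_ring_1"
  assumes hom_1: "h 1 = 1"
    and hom_add: "h (x + y) = h x + h y"
    and hom_mult: "h (x * y) = h x * h y"
begin

lemma hom_0: "h 0 = 0"
  using hom_add[of 0 0] by simp

lemma hom_uminus: "h (- x) = - h x"
  using hom_add[of x "- x"] by (simp add: hom_0 add_eq_0_iff)

lemma hom_diff: "h (x - y) = h x - h y"
  using hom_add[of x "- y"] by (simp add: hom_uminus)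

lemma hom_sum: "h (sum f A) = (\<Sum>x\<in>A. h (f x))"
  by (induction A rule: infinite_finite_induct) (auto simp: hom_0 hom_add)

lemma coeff_hom: "coeff (map_poly h p) n = h (coeff p n)"
  by (simp add: coeff_map_poly hom_0)

lemma map_poly_hom: "ring_hom_fun (map_poly h)"
  by unfold_locales (auto simp: poly_eq_iff coeff_hom hom_add coeff_mult hom_sum hom_mult hom_1 hom_0)

lemma poly_map_poly_hom: "poly (map_poly h p) (h x) = h (poly p x)"
  by (induction p) (auto simp: map_poly_pCons hom_add hom_mult hom_0)

end

interpretation ac: ring_hom_fun to_ac
  by unfold_locales auto

interpretation ac_poly: ring_hom_fun "map_poly to_ac"
  by (rule ac.map_poly_hom)

lemma map_poly_to_ac_eq_0_iff [simp]: "map_poly to_ac p = 0 \<longleftrightarrow> p = 0"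
  by (simp add: map_poly_eq_0_iff)

lemma degree_map_poly_to_ac [simp]: "degree (map_poly to_ac p) = degree p"
  by (simp add: degree_map_poly)

text \<open>In the ideal \<open>I\<close> generated by \<open>q\<close> and \<open>a\<close>, a
  nonzero element \<open>d\<close> of least degree divides every element. As \<open>q\<close> is
  irreducible, \<open>d\<close> is a unit or associated to \<open>q\<close>; the second case would
  make \<open>q\<close> divide \<open>a\<close>.\<close>

lemma bezout_irreducible:
  fixes q a :: "'k::field poly"
  assumes "irreducible q" "\<not> q dvd a"
  obtains s t where "s * q + t * a = 1"
proof -
  define I where "I = {s * q + t * a | s t. True}"
  have "q \<noteq> 0"
    using assms(1) by auto
  have "q \<in> I"
    unfolding I_def by (rule CollectI, rule exI[of _ 1], rule exI[of _ 0]) simp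
  have "a \<in> I"
    unfolding I_def by (rule CollectI, rule exI[of _ 0], rule exI[of _ 1]) simp
  have "\<exists>d. (d \<in> I \<and> d \<noteq> 0) \<and> (\<forall>e. e \<in> I \<and> e \<noteq> 0 \<longrightarrow> degree d \<le> degree e)"
    using \<open>q \<in> I\<close> \<open>q \<noteq> 0\<close> by (intro ex_has_least_nat[where k = q]) auto
  then obtain d where d: "d \<in> I" "d \<noteq> 0" "\<And>e. e \<in> I \<Longrightarrow> e \<noteq> 0 \<Longrightarrow> degree d \<le> degree e"
    by blast
  have I_closed: "x - c * y \<in> I" if xy: "x \<in> I" "y \<in> I" for x y c
  proof -
    obtain s t s' t' where "x = s * q + t * a" "y = s' * q + t' * a"
      using xy by (auto simp: I_def)
    then have "x - c * y = (s - c * s') * q + (t - c * t') * a"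
      by (simp add: algebra_simps)
    then show ?thesis
      by (auto simp: I_def)
  qed
  have dvd: "d dvd e" if "e \<in> I" for e
  proof -
    have "e mod d = e - (e div d) * d"
      by (simp add: minus_div_mult_eq_mod)
    then have "e mod d \<in> I"
      using I_closed that d(1) by simp
    then have "e mod d = 0"
      using d(2) d(3)[of "e mod d"] degree_mod_less[of d e] by fastforce
    then show ?thesis
      by auto
  qed
  obtain c where c: "q = d * c"
    using dvd \<open>q \<in> I\<close> by blast
  have "is_unit d \<or> is_unit c"
    using assms(1) c by (simp add: irreducible_def)
  moreover have "\<not> is_unit c"
  proof
    assume "is_unit c"
    then have "q dvd d"
      using c by (simp add: mult_unit_dvd_iff)
    then show False
      using dvd[OF \<open>a \<in> I\<close>] assms(2) dvd_trans by blast
  qed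
  ultimately obtain e where e: "1 = d * e"
    by blast
  obtain s t where "d = s * q + t * a"
    using d(1) by (auto simp: I_def)
  then have "(e * s) * q + (e * t) * a = 1"
    using e by (simp add: algebra_simps)
  then show ?thesis
    by (rule that)
qed

text \<open>If \<open>q\<close> did not divide \<open>a\<close>, evaluating a Bezout identity at the
  common root would give 0 = 1. So \<open>q\<close> acts as a minimal polynomial of
  \<open>x\<close>.\<close>

lemma irreducible_dvd_iff_root:
  assumes "irreducible q" "poly (map_poly to_ac q) x = 0"
  shows "poly (map_poly to_ac a) x = 0 \<longleftrightarrow> q dvd a"
proof
  assume a: "poly (map_poly to_ac a) x = 0"
  show "q dvd a"
  proof (rule ccontr)
    assume "\<not> q dvd a"
    then obtain s t where "s * q + t * a = 1"
      using assms(1) bezout_irreducible by blast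
    then have "poly (map_poly to_ac (s * q + t * a)) x = 1"
      by (simp add: ac_poly.hom_1)
    then show False
      using a assms(2) by (simp add: ac_poly.hom_add ac_poly.hom_mult)
  qed
qed (use assms(2) in \<open>auto simp: ac_poly.hom_mult\<close>)

subsection \<open>Automorphisms of the algebraic closure\<close>

definition closure_aut :: "('a::field alg_closure \<Rightarrow> 'a alg_closure) \<Rightarrow> bool" where
  "closure_aut \<sigma> \<longleftrightarrow> bij \<sigma> \<and> ring_hom_fun \<sigma> \<and> (\<forall>a. \<sigma> (to_ac a) = to_ac a)"

text \<open>The graph of a homomorphism over the base field from a subring of the closure. Extension
  is then plain inclusion, which suits Zorn's lemma. Single-valuedness is only demanded at 0;
  elsewhere it follows by taking differences (\<open>partial_aut_unique\<close>).\<close>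

definition partial_aut :: "('a::field alg_closure \<times> 'a alg_closure) set \<Rightarrow> bool" where
  "partial_aut S \<longleftrightarrow> (\<forall>a. (to_ac a, to_ac a) \<in> S) \<and>
     (\<forall>x x' y y'. (x, x') \<in> S \<longrightarrow> (y, y') \<in> S \<longrightarrow> (x + y, x' + y') \<in> S \<and> (x * y, x' * y') \<in> S) \<and>
     (\<forall>y. (0, y) \<in> S \<longrightarrow> y = 0)"

context
  fixes S :: "('a::field alg_closure \<times> 'a alg_closure) set"
  assumes S: "partial_aut S"
begin

lemma partial_aut_const: "(to_ac a, to_ac a) \<in> S"
  and partial_aut_add: "(x, x') \<in> S \<Longrightarrow> (y, y') \<in> S \<Longrightarrow> (x + y, x' + y') \<in> S"
  and partial_aut_mult: "(x, x') \<in> S \<Longrightarrow> (y, y') \<in> S \<Longrightarrow> (x * y, x' * y') \<in> S"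
  and partial_aut_0D: "(0, y) \<in> S \<Longrightarrow> y = 0"
  using S by (auto simp: partial_aut_def)

lemma partial_aut_0: "(0, 0) \<in> S"
  using partial_aut_const[of 0] by simp

lemma partial_aut_1: "(1, 1) \<in> S"
  using partial_aut_const[of 1] by simp

lemma partial_aut_diff: "(x, x') \<in> S \<Longrightarrow> (y, y') \<in> S \<Longrightarrow> (x - y, x' - y') \<in> S"
  using partial_aut_add[of x x' "- y" "- y'"] partial_aut_mult[of "to_ac (-1)" "to_ac (-1)" y y']
    partial_aut_const[of "-1"] by simp

lemma partial_aut_unique: "(x, y) \<in> S \<Longrightarrow> (x, z) \<in> S \<Longrightarrow> y = z"
  using partial_aut_diff[of x y x z] partial_aut_0D[of "y - z"] by simp

lemma partial_aut_poly:
  assumes "\<And>i. (coeff q i, coeff q' i) \<in> S" "(x, x') \<in> S"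
  shows "(poly q x, poly q' x') \<in> S"
  using assms(1)
proof (induction "max (degree q) (degree q')" arbitrary: q q' rule: less_induct)
  case less
  obtain a p a' p' where q: "q = pCons a p" "q' = pCons a' p'"
    by (metis pCons_cases)
  have "(a, a') \<in> S"
    using less(2)[of 0] by (simp add: q)
  show ?case
  proof (cases "p = 0 \<and> p' = 0")
    case True
    with \<open>(a, a') \<in> S\<close> show ?thesis by (simp add: q)
  next
    case False
    have p: "(coeff p i, coeff p' i) \<in> S" for i
      using less(2)[of "Suc i"] by (simp add: q)
    have "max (degree p) (degree p') < max (degree q) (degree q')"
      using False by (auto simp: q)
    then have "(poly p x, poly p' x') \<in> S"
      using less(1) p by blast
    then show ?thesis
      using \<open>(a, a') \<in> S\<close> assms(2) by (simp add: q partial_aut_add partial_aut_mult)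
  qed
qed

text \<open>The domain of \<open>S\<close> is a field: if \<open>p = c + X q\<close> is a polynomial
  over the base field of least degree with root \<open>x\<close>, then \<open>c\<close> is nonzero
  and \<open>1/x = - q(x) / c\<close> is a polynomial in \<open>x\<close>.\<close>

lemma partial_aut_inverse:
  assumes "(x, x') \<in> S" "x \<noteq> 0"
  shows "\<exists>z. (inverse x, z) \<in> S"
proof -
  have "\<exists>p::'a poly. p \<noteq> 0 \<and> poly (map_poly to_ac p) x = 0"
    using alg_closure_algebraic by blast
  then obtain p :: "'a poly" where p: "p \<noteq> 0" "poly (map_poly to_ac p) x = 0"
    and min: "\<And>q. q \<noteq> 0 \<Longrightarrow> poly (map_poly to_ac q) x = 0 \<Longrightarrow> degree p \<le> degree q"
    using ex_has_least_nat[of "\<lambda>p::'a poly. p \<noteq> 0 \<and> poly (map_poly to_ac p) x = 0" _ degree] by blast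
  obtain c q where pc: "p = pCons c q"
    by (metis pCons_cases)
  have "c \<noteq> 0"
  proof
    assume "c = 0"
    then have "q \<noteq> 0" "poly (map_poly to_ac q) x = 0"
      using p pc assms(2) by (auto simp: map_poly_pCons)
    then show False
      using min[of q] pc by simp
  qed
  have eq: "to_ac c + x * poly (map_poly to_ac q) x = 0"
    using p(2) by (simp add: pc map_poly_pCons)
  have "inverse x = to_ac (- inverse c) * poly (map_poly to_ac q) x"
    using eq \<open>c \<noteq> 0\<close> assms(2) by (simp add: field_simps eq_neg_iff_add_eq_0)
  moreover have "(poly (map_poly to_ac q) x, poly (map_poly to_ac q) x') \<in> S"
    using assms(1) by (intro partial_aut_poly) (auto simp: ac.coeff_hom partial_aut_const)
  ultimately show ?thesis
    using partial_aut_mult[OF partial_aut_const[of "- inverse c"]] by metis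
qed

text \<open>Adjoins one element: \<open>p\<close> is the minimal polynomial of \<open>x\<close> over
  the domain of \<open>S\<close> and \<open>p'\<close> its image, so sending \<open>x\<close> to a
  root \<open>y\<close> of \<open>p'\<close> is well defined.\<close>

lemma partial_aut_extend:
  assumes p: "\<And>i. (coeff p i, coeff p' i) \<in> S" "lead_coeff p = 1"
    and roots: "poly p x = 0" "poly p' y = 0"
    and min: "\<And>q q'. (\<And>i. (coeff q i, coeff q' i) \<in> S) \<Longrightarrow> q \<noteq> 0 \<Longrightarrow> poly q x = 0 \<Longrightarrow> degree p \<le> degree q"
  shows "\<exists>S'. partial_aut S' \<and> S \<subseteq> S' \<and> (x, y) \<in> S'"
proof -
  \<comment> \<open>Well-definedness. Division of \<open>q\<close> by \<open>p\<close> is run in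
    parallel with division of \<open>q'\<close> by \<open>p'\<close>. The induction is on a strict
    bound \<open>n\<close> for the exponents in \<open>q\<close>, which also covers
    \<open>q = 0\<close>.\<close>
  have vanish: "poly q' y = 0"
    if "\<And>i. (coeff q i, coeff q' i) \<in> S" "poly q x = 0" "\<And>i. i \<ge> n \<Longrightarrow> coeff q i = 0" for q q' n
    using that
  proof (induction n arbitrary: q q')
    case 0
    then have "coeff q' i = 0" for i
      using partial_aut_0D by (metis zero_le)
    then show ?case
      by (simp add: poly_altdef)
  next
    case (Suc n)
    show ?case
    proof (cases "n < degree p")
      case True
      have "q = 0"
      proof (rule ccontr)
        assume "q \<noteq> 0"
        with Suc True show False
          using min[of q q'] leading_coeff_neq_0[of q]
          by (metis Suc_leI leD less_le_trans linorder_not_less not_less_eq_eq)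
      qed
      then have "coeff q' i = 0" for i
        using Suc(2)[of i] partial_aut_0D by simp
      then show ?thesis
        by (simp add: poly_altdef)
    next
      case False
      define k where "k = n - degree p"
      define r where "r = q - monom (coeff q n) k * p"
      define r' where "r' = q' - monom (coeff q' n) k * p'"
      have n: "n = k + degree p"
        using False by (simp add: k_def)
      have "(coeff r i, coeff r' i) \<in> S" for i
        unfolding r_def r'_def using p(1) Suc(2) partial_aut_0
        by (auto simp: coeff_monom_mult intro!: partial_aut_diff partial_aut_mult)
      moreover have "poly r x = 0"
        using Suc(3) roots by (simp add: r_def)
      moreover have "coeff r i = 0" if "i \<ge> n" for i
      proof (cases "i = n")
        case True
        then show ?thesis
          using p(2) n by (simp add: r_def coeff_monom_mult)
      next
        case False
        then have "coeff q i = 0" "coeff p (i - k) = 0"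
          using that Suc(4) n by (auto intro!: coeff_eq_0)
        then show ?thesis
          by (simp add: r_def coeff_monom_mult)
      qed
      ultimately have "poly r' y = 0"
        using Suc(1) by blast
      then show ?thesis
        using roots by (simp add: r'_def)
    qed
  qed
  define S' where "S' = {(poly q x, poly q' y) | q q'. \<forall>i. (coeff q i, coeff q' i) \<in> S}"
  have S'I: "(poly q x, poly q' y) \<in> S'" if "\<And>i. (coeff q i, coeff q' i) \<in> S" for q q'
    using that by (auto simp: S'_def)
  have sub: "S \<subseteq> S'"
  proof clarify
    fix a b assume "(a, b) \<in> S"
    then show "(a, b) \<in> S'"
      using S'I[of "[:a:]" "[:b:]"] partial_aut_0 by (simp add: coeff_pCons split: nat.splits)
  qed
  have xy: "(x, y) \<in> S'"
    using S'I[of "[:0,1:]" "[:0,1:]"] partial_aut_0 partial_aut_1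
    by (simp add: coeff_pCons split: nat.splits)
  have sum_in: "(sum f A, sum g A) \<in> S" if "\<And>i. i \<in> A \<Longrightarrow> (f i, g i) \<in> S" for f g and A :: "nat set"
    using that by (induction A rule: infinite_finite_induct) (auto intro: partial_aut_0 partial_aut_add)
  have "partial_aut S'"
    unfolding partial_aut_def
  proof (intro conjI allI impI)
    fix a show "(to_ac a, to_ac a) \<in> S'"
      using sub partial_aut_const by blast
  next
    fix a a' b b' assume "(a, a') \<in> S'" "(b, b') \<in> S'"
    then obtain q q' t t' where q: "a = poly q x" "a' = poly q' y" "\<And>i. (coeff q i, coeff q' i) \<in> S"
      and t: "b = poly t x" "b' = poly t' y" "\<And>i. (coeff t i, coeff t' i) \<in> S"
      unfolding S'_def by blast
    show "(a + b, a' + b') \<in> S'"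
      using S'I[of "q + t" "q' + t'"] q t partial_aut_add by simp
    show "(a * b, a' * b') \<in> S'"
      using S'I[of "q * t" "q' * t'"] q t by (simp add: coeff_mult sum_in partial_aut_mult)
  next
    fix z assume "(0, z) \<in> S'"
    then obtain q q' where q: "0 = poly q x" "z = poly q' y" "\<And>i. (coeff q i, coeff q' i) \<in> S"
      unfolding S'_def by blast
    then show "z = 0"
      using vanish[of q q' "Suc (degree q)"] by (simp add: coeff_eq_0)
  qed
  then show ?thesis
    using sub xy by blast
qed

end

text \<open>Over the domain of a maximal \<open>S\<close>, take \<open>p\<close> monic of least
  degree vanishing at \<open>x\<close>. Its image \<open>p'\<close> has a root \<open>y\<close> in
  the algebraically closed field, so \<open>S\<close> extends to a graph containing
  \<open>(x, y)\<close>; by maximality the pair is already there.\<close>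

lemma partial_aut_total:
  assumes S: "partial_aut S" and max: "\<And>S'. partial_aut S' \<Longrightarrow> S \<subseteq> S' \<Longrightarrow> S' = S"
  shows "\<exists>y. (x, y) \<in> S"
proof -
  define R where "R = (\<lambda>q. \<exists>q'. \<forall>i. (coeff q i, coeff q' i) \<in> S)"
  have "\<exists>p. R p \<and> p \<noteq> 0 \<and> poly p x = 0"
  proof -
    obtain p where "p \<noteq> 0" "poly (map_poly to_ac p) x = 0"
      using alg_closure_algebraic by blast
    moreover have "R (map_poly to_ac p)"
      unfolding R_def using S by (intro exI[of _ "map_poly to_ac p"]) (auto simp: ac.coeff_hom partial_aut_const)
    ultimately show ?thesis
      by (intro exI[of _ "map_poly to_ac p"]) simp
  qed
  then obtain p0 where p0: "R p0" "p0 \<noteq> 0" "poly p0 x = 0"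
    and min: "\<And>q. R q \<Longrightarrow> q \<noteq> 0 \<Longrightarrow> poly q x = 0 \<Longrightarrow> degree p0 \<le> degree q"
    using ex_has_least_nat[of "\<lambda>p. R p \<and> p \<noteq> 0 \<and> poly p x = 0" _ degree] by blast
  obtain p0' where p0': "\<And>i. (coeff p0 i, coeff p0' i) \<in> S"
    using p0(1) by (auto simp: R_def)
  obtain z where z: "(inverse (lead_coeff p0), z) \<in> S"
    using partial_aut_inverse[OF S p0'] p0(2) by (metis leading_coeff_neq_0)
  define p where "p = smult (inverse (lead_coeff p0)) p0"
  define p' where "p' = smult z p0'"
  have p: "(coeff p i, coeff p' i) \<in> S" for i
    using z p0' by (simp add: p_def p'_def partial_aut_mult[OF S])
  have lc: "lead_coeff p = 1" and deg: "degree p = degree p0" and root: "poly p x = 0"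
    using p0 by (auto simp: p_def)
  \<comment> \<open>The leading coefficient 1 of \<open>p\<close> can only be paired with 1, so
    \<open>p'\<close> has at least the degree of \<open>p\<close>.\<close>
  have "degree p' > 0"
  proof -
    have "(1, coeff p' (degree p)) \<in> S"
      using p[of "degree p"] lc by simp
    then have "coeff p' (degree p) = 1"
      using partial_aut_unique[OF S] partial_aut_1[OF S] by blast
    moreover have "degree p > 0"
      using lc root by (metis degree_eq_zeroE gr0I lead_coeff_pCons(2) pCons_0_0 poly_1 one_pCons zero_neq_one)
    ultimately show ?thesis
      using le_degree[of p' "degree p"] by simp
  qed
  then obtain y where "poly p' y = 0"
    using alg_closed_imp_poly_has_root by blast
  then obtain S' where "partial_aut S'" "S \<subseteq> S'" "(x, y) \<in> S'"
    using partial_aut_extend[OF S p lc root] min deg by (metis R_def)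
  then show ?thesis
    using max by blast
qed

lemma partial_aut_Union:
  assumes "subset.chain {S. partial_aut S} C" "C \<noteq> {}"
  shows "partial_aut (\<Union>C)"
proof -
  have C: "partial_aut S" if "S \<in> C" for S
    using assms(1) that by (auto simp: subset_chain_def)
  have common: "\<exists>S\<in>C. p \<in> S \<and> q \<in> S" if "p \<in> \<Union>C" "q \<in> \<Union>C" for p q
  proof -
    obtain S T where ST: "S \<in> C" "T \<in> C" "p \<in> S" "q \<in> T"
      using \<open>p \<in> \<Union>C\<close> \<open>q \<in> \<Union>C\<close> by blast
    then have "S \<subseteq> T \<or> T \<subseteq> S"
      using assms(1) unfolding subset_chain_def by meson
    with ST show ?thesis
      by blast
  qed
  show ?thesis
    unfolding partial_aut_def
  proof (intro conjI allI impI)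
    fix a show "(to_ac a, to_ac a) \<in> \<Union>C"
      using C assms(2) partial_aut_const by blast
  next
    fix x x' y y' assume "(x, x') \<in> \<Union>C" "(y, y') \<in> \<Union>C"
    then obtain S where "S \<in> C" "(x, x') \<in> S" "(y, y') \<in> S"
      using common by blast
    then show "(x + y, x' + y') \<in> \<Union>C" "(x * y, x' * y') \<in> \<Union>C"
      using C partial_aut_add partial_aut_mult by blast+
  next
    fix y assume "(0, y) \<in> \<Union>C"
    then show "y = 0"
      using C partial_aut_0D by blast
  qed
qed

text \<open>Field homomorphisms are injective. For surjectivity, \<open>\<sigma>\<close> maps the
  finite root set of a polynomial over the base field into itself, hence onto itself, and every
  element lies in such a set.\<close>

lemma closure_aut_if_hom:
  assumes "ring_hom_fun \<sigma>" "\<And>a. \<sigma> (to_ac a) = to_ac a"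
  shows "closure_aut \<sigma>"
proof -
  interpret ring_hom_fun \<sigma> by fact
  have inj: "inj \<sigma>"
  proof (rule injI)
    fix x y assume "\<sigma> x = \<sigma> y"
    show "x = y"
    proof (rule ccontr)
      assume "x \<noteq> y"
      then have "\<sigma> ((x - y) * inverse (x - y)) = 1"
        by (simp add: hom_1)
      then show False
        using \<open>\<sigma> x = \<sigma> y\<close> by (simp add: hom_mult hom_diff)
    qed
  qed
  have "y \<in> range \<sigma>" for y
  proof -
    obtain p where p: "p \<noteq> 0" "poly (map_poly to_ac p) y = 0"
      using alg_closure_algebraic by blast
    let ?R = "{x. poly (map_poly to_ac p) x = 0}"
    have eq: "map_poly \<sigma> (map_poly to_ac p) = map_poly to_ac p"
      by (simp add: poly_eq_iff coeff_hom ac.coeff_hom assms(2))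
    have "\<sigma> ` ?R \<subseteq> ?R"
      using poly_map_poly_hom[of "map_poly to_ac p"] by (auto simp: eq hom_0)
    moreover have "finite ?R"
      using p(1) by (intro poly_roots_finite) simp
    ultimately have "\<sigma> ` ?R = ?R"
      using inj by (intro endo_inj_surj) (auto intro: inj_on_subset)
    then show ?thesis
      using p(2) by blast
  qed
  then show ?thesis
    using assms inj by (auto simp: closure_aut_def bij_def)
qed

text \<open>The identity of the base field is first extended by sending \<open>x\<close> to
  \<open>y\<close>, with \<open>q\<close> made monic as the minimal polynomial; Zorn's lemma then
  gives a maximal graph, which is total.\<close>

lemma closure_aut_transitive:
  assumes q: "irreducible q" and roots: "poly (map_poly to_ac q) x = 0" "poly (map_poly to_ac q) y = 0"
  obtains \<sigma> where "closure_aut \<sigma>" "\<sigma> x = y"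
proof -
  define D where "D = range (\<lambda>a::'a. (to_ac a, to_ac a))"
  have D: "partial_aut D"
    unfolding partial_aut_def
  proof (intro conjI allI impI)
    fix x x' y y' assume "(x, x') \<in> D" "(y, y') \<in> D"
    then obtain a b where ab: "x = to_ac a" "x' = to_ac a" "y = to_ac b" "y' = to_ac b"
      by (auto simp: D_def)
    show "(x + y, x' + y') \<in> D" "(x * y, x' * y') \<in> D"
      unfolding ab D_def by (auto simp flip: to_ac_add to_ac_mult)
  qed (auto simp: D_def)
  have "q \<noteq> 0"
    using q by auto
  define p where "p = map_poly to_ac (smult (inverse (lead_coeff q)) q)"
  have "poly p z = to_ac (inverse (lead_coeff q)) * poly (map_poly to_ac q) z" for z
    by (simp add: p_def map_poly_smult)
  then have p: "poly p x = 0" "poly p y = 0"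
    using roots by auto
  have lc: "lead_coeff p = 1"
    using \<open>q \<noteq> 0\<close> by (simp add: p_def ac.coeff_hom flip: to_ac_mult)
  have "degree p \<le> degree t"
    if t: "\<And>i. (coeff t i, coeff t' i) \<in> D" "t \<noteq> 0" "poly t x = 0" for t t'
  proof -
    \<comment> \<open>The coefficients of \<open>t\<close> lie in the base field by definition of
      \<open>D\<close>, so \<open>t\<close> descends to a polynomial \<open>a\<close> there.\<close>
    define a where "a = map_poly of_ac t"
    have "to_ac (of_ac (coeff t i)) = coeff t i" for i
      using t(1)[of i] by (auto simp: D_def)
    then have ta: "t = map_poly to_ac a"
      by (simp add: a_def poly_eq_iff coeff_map_poly)
    then have "q dvd a"
      using irreducible_dvd_iff_root[OF q roots(1)] t(3) by simp
    then have "degree q \<le> degree a"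
      using t(2) ta by (intro dvd_imp_degree_le) auto
    then show ?thesis
      using \<open>q \<noteq> 0\<close> by (simp add: p_def ta)
  qed
  then obtain S0 where S0: "partial_aut S0" "D \<subseteq> S0" "(x, y) \<in> S0"
    using partial_aut_extend[OF D _ lc p] by (metis (no_types, lifting) D_def ac.coeff_hom p_def rangeI)
  define A where "A = {S. partial_aut S \<and> S0 \<subseteq> S}"
  have "\<exists>M\<in>A. \<forall>T\<in>A. M \<subseteq> T \<longrightarrow> (T = M)"
  proof (rule subset_Zorn_nonempty)
    fix C assume C: "C \<noteq> {}" "subset.chain A C"
    then have "subset.chain {S. partial_aut S} C"
      unfolding subset_chain_def A_def by blast
    then have "partial_aut (\<Union>C)"
      using C partial_aut_Union by blast
    moreover have "S0 \<subseteq> \<Union>C"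
      using C unfolding subset_chain_def A_def by blast
    ultimately show "\<Union>C \<in> A"
      by (simp add: A_def)
  qed (use S0 in \<open>auto simp: A_def\<close>)
  then obtain M where M: "partial_aut M" "S0 \<subseteq> M" "\<And>T. partial_aut T \<Longrightarrow> M \<subseteq> T \<Longrightarrow> T = M"
    unfolding A_def by (auto 0 4)
  define \<sigma> where "\<sigma> = (\<lambda>a. SOME b. (a, b) \<in> M)"
  have M_\<sigma>: "(a, \<sigma> a) \<in> M" for a
    unfolding \<sigma>_def by (rule someI_ex) (rule partial_aut_total[OF M(1,3)])
  note uniq = partial_aut_unique[OF M(1) M_\<sigma>]
  have "ring_hom_fun \<sigma>"
    by unfold_locales
      (use M_\<sigma> M(1) in \<open>blast intro: uniq partial_aut_1 partial_aut_add partial_aut_mult\<close>)+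
  then have "closure_aut \<sigma>"
    using closure_aut_if_hom uniq partial_aut_const[OF M(1)] by blast
  moreover have "\<sigma> x = y"
    using uniq S0(3) M(2) by blast
  ultimately show ?thesis
    by (rule that)
qed

subsection \<open>Weights\<close>

lemma hull_rel_imp_abs_eq: "hull_rel p q \<Longrightarrow> abs_div_hull p = abs_div_hull q"
  by (rule Quotient_rel_abs[OF Quotient_div_hull])

lemma nat_mult_abs_div_hull:
  assumes "0 < m"
  shows "nat_mult n (abs_div_hull (x, m)) = abs_div_hull (nat_mult n x, m)"
proof (induction n)
  case 0
  show ?case
    using assms by (simp add: zero_div_hull_def hull_rel_imp_abs_eq hull_rel_def)
next
  case (Suc n)
  have "abs_div_hull (x, m) + abs_div_hull (nat_mult n x, m) =
      abs_div_hull (nat_mult m x + nat_mult m (nat_mult n x), m * m)"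
    using assms by (subst plus_div_hull.abs_eq) (auto simp: hull_rel_def)
  also have "\<dots> = abs_div_hull (nat_mult (Suc n) x, m)"
    using assms by (intro hull_rel_imp_abs_eq)
      (simp add: hull_rel_def nat_mult_add nat_mult_assoc nat_mult_Suc mult_ac)
  finally show ?case
    by (simp add: nat_mult_Suc Suc)
qed

lemma nat_mult_hull_div:
  assumes "0 < n"
  shows "nat_mult n (hull_div \<gamma> n) = \<gamma>"
proof -
  obtain x m where \<gamma>: "\<gamma> = abs_div_hull (x, m)" "0 < m"
    by (induction \<gamma> rule: div_hull.abs_induct) (force simp: hull_rel_def)
  have "hull_div \<gamma> n = abs_div_hull (x, n * m)"
    using assms \<gamma> by (simp add: hull_div.abs_eq hull_rel_def)
  then show ?thesis
    using assms \<gamma> by (auto simp: nat_mult_abs_div_hull nat_mult_assoc hull_rel_def mult_ac intro!: hull_rel_imp_abs_eq)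
qed

lemma hull_div_le_iff:
  assumes "0 < m" "0 < n"
  shows "hull_div \<gamma> m \<le> hull_div \<delta> n \<longleftrightarrow> nat_mult n \<gamma> \<le> nat_mult m \<delta>"
proof -
  have "hull_div \<gamma> m \<le> hull_div \<delta> n \<longleftrightarrow> nat_mult (n * m) (hull_div \<gamma> m) \<le> nat_mult (m * n) (hull_div \<delta> n)"
    using assms by (subst mult.commute) (simp add: nat_mult_le_iff)
  then show ?thesis
    using assms by (simp add: nat_mult_hull_div flip: nat_mult_assoc)
qed

lemma monic_nonzero: "monic f \<Longrightarrow> f \<noteq> 0"
  by (auto simp: monic_def)

subsection \<open>Averaging over conjugates\<close>

lemma sum_mset_repeat_mset: "sum_mset (repeat_mset k A) = nat_mult k (sum_mset A)"
  by (induction k) (simp_all add: nat_mult_Suc)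

lemma image_mset_repeat_mset: "image_mset f (repeat_mset k A) = repeat_mset k (image_mset f A)"
  by (induction k) simp_all

text \<open>Both multisets are multiples of the same set \<open>R\<close>, so the sums over them are
  in the ratio of their sizes.\<close>

lemma sum_mset_proportional:
  fixes f :: "'b \<Rightarrow> 'h::linordered_ab_group_add"
  assumes "finite R" "set_mset M \<subseteq> R" "set_mset N \<subseteq> R"
    and const: "\<And>a b. a \<in> R \<Longrightarrow> b \<in> R \<Longrightarrow> count M a = count M b \<and> count N a = count N b"
  shows "nat_mult (size N) (\<Sum>x\<in>#M. f x) = nat_mult (size M) (\<Sum>x\<in>#N. f x)"
proof (cases "R = {}")
  case False
  then obtain a where "a \<in> R" by blast
  have "K = repeat_mset (count K a) (mset_set R)" if "K = M \<or> K = N" for K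
  proof (rule multiset_eqI)
    fix b show "count K b = count (repeat_mset (count K a) (mset_set R)) b"
    proof (cases "b \<in> R")
      case True
      then show ?thesis
        using const[OF \<open>a \<in> R\<close> True] that assms(1) by auto
    next
      case False
      then have "b \<notin># K"
        using that assms(2,3) by auto
      then show ?thesis
        using False by (simp add: count_eq_zero_iff)
    qed
  qed
  then obtain k l where "M = repeat_mset k (mset_set R)" "N = repeat_mset l (mset_set R)"
    by blast
  then show ?thesis
    by (simp add: image_mset_repeat_mset sum_mset_repeat_mset nat_mult_assoc mult_ac)
qed (use assms in simp)

text \<open>Multiplicities are kept because irreducible polynomials may be inseparable.\<close>

definition roots :: "'a::field poly \<Rightarrow> 'a alg_closure multiset" where
  "roots f = proots (map_poly to_ac f)"

lemma set_roots: "f \<noteq> 0 \<Longrightarrow> set_mset (roots f) = {x. poly (map_poly to_ac f) x = 0}"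
  by (simp add: roots_def)

lemma proots_prod_linear: "proots (\<Prod>a\<in>#A. [:-a, 1:]) = A"
proof -
  have "(\<Sum>a\<in>#A. proots [:-a, 1:]) = A"
    by (induction A) auto
  then show ?thesis
    using proots_prod_mset[of "image_mset (\<lambda>a. [:-a, 1:]) A"]
    by (simp add: image_mset.compositionality o_def image_iff)
qed

lemma map_poly_to_ac_factor:
  assumes "f \<noteq> 0"
  shows "map_poly to_ac f = smult (to_ac (lead_coeff f)) (\<Prod>a\<in>#roots f. [:-a, 1:])"
    and "size (roots f) = degree f"
proof -
  obtain A where A: "size A = degree f"
    "map_poly to_ac f = smult (to_ac (lead_coeff f)) (\<Prod>a\<in>#A. [:-a, 1:])"
    using alg_closed_imp_factorization[of "map_poly to_ac f"] assms by (auto simp: ac.coeff_hom)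
  then have "roots f = A"
    using assms by (simp add: roots_def proots_prod_linear)
  with A show "map_poly to_ac f = smult (to_ac (lead_coeff f)) (\<Prod>a\<in>#roots f. [:-a, 1:])"
    and "size (roots f) = degree f"
    by simp_all
qed

section \<open>The action of automorphisms on roots\<close>

lemma closure_aut_id: "closure_aut id"
  by (auto simp: closure_aut_def ring_hom_fun_def)

lemma closure_aut_comp: "closure_aut \<sigma> \<Longrightarrow> closure_aut \<tau> \<Longrightarrow> closure_aut (\<sigma> \<circ> \<tau>)"
  by (auto simp: closure_aut_def ring_hom_fun_def bij_comp)

lemma closure_aut_inj: "closure_aut \<sigma> \<Longrightarrow> inj \<sigma>"
  by (simp add: closure_aut_def bij_def)

text \<open>Applying \<open>\<sigma>\<close> to the coefficients fixes \<open>f\<close> and moves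
  the roots in its linear factorization; reading off the roots of both sides compares them with
  multiplicity.\<close>

lemma image_roots:
  assumes "closure_aut \<sigma>" "f \<noteq> 0"
  shows "image_mset \<sigma> (roots f) = roots f"
proof -
  interpret ring_hom_fun \<sigma> using assms(1) by (simp add: closure_aut_def)
  interpret p: ring_hom_fun "map_poly \<sigma>" by (rule map_poly_hom)
  have fixed: "\<sigma> (to_ac a) = to_ac a" for a
    using assms(1) by (simp add: closure_aut_def)
  have prod: "map_poly \<sigma> (\<Prod>a\<in>#A. [:-a, 1:]) = (\<Prod>a\<in>#image_mset \<sigma> A. [:-a, 1:])" for A
  proof (induction A)
    case (add a A)
    have "map_poly \<sigma> [:-a, 1:] = [:- \<sigma> a, 1:]"
      by (simp add: map_poly_pCons hom_0 hom_1 hom_uminus)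
    with add show ?case
      by (simp add: p.hom_mult del: mult_pCons_left)
  qed (simp add: hom_1)
  have "map_poly to_ac f = map_poly \<sigma> (map_poly to_ac f)"
    by (simp add: poly_eq_iff coeff_hom ac.coeff_hom fixed)
  also have "\<dots> = map_poly \<sigma> (smult (to_ac (lead_coeff f)) (\<Prod>a\<in>#roots f. [:-a, 1:]))"
    using map_poly_to_ac_factor(1)[OF assms(2)] by simp
  also have "\<dots> = smult (to_ac (lead_coeff f)) (\<Prod>a\<in>#image_mset \<sigma> (roots f). [:-a, 1:])"
    by (subst map_poly_smult) (simp_all add: hom_0 hom_mult fixed prod)
  finally have "roots f = proots (smult (to_ac (lead_coeff f)) (\<Prod>a\<in>#image_mset \<sigma> (roots f). [:-a, 1:]))"
    by (simp add: roots_def)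
  then show ?thesis
    using assms(2) proots_prod_linear[of "image_mset \<sigma> (roots f)"] by simp
qed

lemma closure_aut_roots:
  assumes "closure_aut \<sigma>" "f \<noteq> 0" "a \<in># roots f"
  shows "\<sigma> a \<in># roots f"
  using image_roots[OF assms(1,2)] assms(3) by (metis image_eqI set_image_mset)

text \<open>The value 0 at \<open>Top\<close> is a dummy: the weight computations apply this only to
  differences of \<theta> and roots of polynomials that do not vanish at \<theta>.\<close>

definition finite_part :: "'h::zero top \<Rightarrow> 'h" where
  "finite_part x = (case x of Top \<Rightarrow> 0 | Value a \<Rightarrow> a)"

lemma Value_finite_part: "x \<noteq> Top \<Longrightarrow> Value (finite_part x) = x"
  by (cases x) (auto simp: finite_part_def)

lemma inj_image_mset_count:
  assumes "inj f" shows "count (image_mset f A) (f a) = count A a"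
  using assms by (induction A) (auto dest: injD)

text \<open>The orbit of the pair under simultaneous conjugation; it couples the conjugates of
  \<alpha> with those of \<beta>.\<close>

definition conjugate_pairs ::
    "'a::field alg_closure \<Rightarrow> 'a alg_closure \<Rightarrow> ('a alg_closure \<times> 'a alg_closure) set" where
  "conjugate_pairs \<alpha> \<beta> = {(\<sigma> \<alpha>, \<sigma> \<beta>) | \<sigma>. closure_aut \<sigma>}"

lemma conjugate_pairs_swap: "prod.swap ` conjugate_pairs \<alpha> \<beta> = conjugate_pairs \<beta> \<alpha>"
  by (force simp: conjugate_pairs_def image_iff)

lemma finite_conjugate_pairs:
  assumes "p \<noteq> 0" "q \<noteq> 0" "\<alpha> \<in># roots p" "\<beta> \<in># roots q"
  shows "finite (conjugate_pairs \<alpha> \<beta>)"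
proof (rule finite_subset)
  show "conjugate_pairs \<alpha> \<beta> \<subseteq> set_mset (roots p) \<times> set_mset (roots q)"
    using assms closure_aut_roots unfolding conjugate_pairs_def by blast
qed auto

text \<open>The first components of the orbit form an automorphism-invariant multiset of roots of
  \<open>p\<close>. Automorphisms act transitively on the roots, so all roots occur equally often in
  it, as they do in \<open>roots p\<close>; the two averages of \<open>f\<close> therefore
  agree.\<close>

lemma sum_conjugate_pairs:
  fixes f :: "'a::field alg_closure \<Rightarrow> 'h::linordered_ab_group_add"
  assumes p: "irreducible p" "\<alpha> \<in># roots p" and q: "q \<noteq> 0" "\<beta> \<in># roots q"
  defines "P \<equiv> conjugate_pairs \<alpha> \<beta>"
  shows "nat_mult (card P) (\<Sum>x\<in>#roots p. f x) = nat_mult (degree p) (\<Sum>z\<in>P. f (fst z))"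
proof -
  have "p \<noteq> 0"
    using p by auto
  have fin: "finite P"
    unfolding P_def using finite_conjugate_pairs \<open>p \<noteq> 0\<close> p q by blast
  define N where "N = image_mset fst (mset_set P)"
  have N_inv: "image_mset \<sigma> N = N" if \<sigma>: "closure_aut \<sigma>" for \<sigma>
  proof -
    have inj: "inj (map_prod \<sigma> \<sigma>)"
      using closure_aut_inj[OF \<sigma>] by (simp add: prod.inj_map)
    have "map_prod \<sigma> \<sigma> ` P \<subseteq> P"
      unfolding P_def conjugate_pairs_def using closure_aut_comp[OF \<sigma>]
      by (auto simp: image_iff) (metis comp_apply)
    then have "map_prod \<sigma> \<sigma> ` P = P"
      using fin inj by (intro endo_inj_surj) (auto intro: inj_on_subset)
    then have "image_mset (map_prod \<sigma> \<sigma>) (mset_set P) = mset_set P"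
      using inj by (metis image_mset_mset_set inj_on_subset subset_UNIV)
    moreover have "image_mset \<sigma> N = image_mset fst (image_mset (map_prod \<sigma> \<sigma>) (mset_set P))"
      by (simp add: N_def image_mset.compositionality o_def)
    ultimately show ?thesis
      by (simp add: N_def)
  qed
  have N_sub: "set_mset N \<subseteq> set_mset (roots p)"
  proof
    fix x assume "x \<in># N"
    then obtain \<sigma> where \<sigma>: "closure_aut \<sigma>" "x = \<sigma> \<alpha>"
      using fin by (auto simp: N_def P_def conjugate_pairs_def)
    then show "x \<in># roots p"
      using closure_aut_roots \<open>p \<noteq> 0\<close> p(2) by blast
  qed
  have const: "count (roots p) a = count (roots p) b \<and> count N a = count N b"
    if ab: "a \<in># roots p" "b \<in># roots p" for a b
  proof -
    obtain \<sigma> where \<sigma>: "closure_aut \<sigma>" "\<sigma> a = b"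
      using closure_aut_transitive[OF p(1), of a b] ab set_roots[OF \<open>p \<noteq> 0\<close>] by auto
    then show ?thesis
      using inj_image_mset_count[OF closure_aut_inj[OF \<sigma>(1)]] image_roots[OF \<sigma>(1) \<open>p \<noteq> 0\<close>] N_inv[OF \<sigma>(1)]
      by metis
  qed
  have "nat_mult (size N) (\<Sum>x\<in>#roots p. f x) = nat_mult (size (roots p)) (\<Sum>x\<in>#N. f x)"
    by (rule sum_mset_proportional[OF _ order_refl N_sub const]) simp_all
  then show ?thesis
    using map_poly_to_ac_factor(2)[OF \<open>p \<noteq> 0\<close>]
    by (simp add: N_def image_mset.compositionality o_def sum_unfold_sum_mset)
qed

section \<open>Weights and root distances over a henselian field\<close>

locale henselian_field =
  fixes v :: "'a::field \<Rightarrow> 'g::linordered_ab_group_add top"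
  assumes hens: "henselian v"
begin

abbreviation "w \<equiv> closure_valuation v"

lemma extends: "extends_to_closure v w"
proof -
  have "\<exists>!w. extends_to_closure v w"
    using hens by (simp add: henselian_def)
  then show ?thesis
    unfolding closure_valuation_def by (rule theI')
qed

sublocale w: valued_ring w
  using extends by unfold_locales (simp add: extends_to_closure_def)

lemma w_eq_Top_iff [simp]: "w x = Top \<longleftrightarrow> x = 0"
  using w.val valuation_eq_Top_iff by blast

text \<open>This is where henselianity enters: composing \<open>w\<close> with
  \<open>\<sigma>\<close> gives another extension of \<open>v\<close>, equal to \<open>w\<close> by
  uniqueness.\<close>

lemma w_closure_aut:
  assumes "closure_aut \<sigma>"
  shows "w (\<sigma> x) = w x"
proof -
  interpret ring_hom_fun \<sigma>
    using assms by (simp add: closure_aut_def)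
  have "valuation (\<lambda>x. w (\<sigma> x))"
    using w.val by (simp add: valuation_def hom_0 hom_1 hom_add hom_mult)
  then have "extends_to_closure v (\<lambda>x. w (\<sigma> x))"
    using extends assms by (simp add: extends_to_closure_def closure_aut_def)
  then have "(\<lambda>x. w (\<sigma> x)) = w"
    using hens extends by (auto simp: henselian_def)
  then show ?thesis
    by metis
qed

lemma root_valuation_eq_sum:
  assumes "f \<noteq> 0"
  shows "root_valuation v \<theta> f = w (to_ac (lead_coeff f)) + (\<Sum>a\<in>#roots f. w (\<theta> - a))"
proof -
  have "poly (\<Prod>a\<in>#A. [:-a, 1:]) \<theta> = (\<Prod>a\<in>#A. \<theta> - a)" for A
    by (induction A) (simp_all add: algebra_simps)
  then have "poly (map_poly to_ac f) \<theta> = to_ac (lead_coeff f) * (\<Prod>a\<in>#roots f. \<theta> - a)"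
    by (subst map_poly_to_ac_factor(1)[OF assms]) simp
  then show ?thesis
    by (simp add: root_valuation_def w.v_mult w.v_prod_mset image_mset.compositionality o_def)
qed

lemma root_valuation_monic:
  assumes "monic f" "poly (map_poly to_ac f) \<theta> \<noteq> 0"
  shows "root_valuation v \<theta> f = Value (\<Sum>a\<in>#roots f. finite_part (w (\<theta> - a)))"
proof -
  have "f \<noteq> 0"
    using assms by auto
  have "(\<Sum>a\<in>#A. w (\<theta> - a)) = Value (\<Sum>a\<in>#A. finite_part (w (\<theta> - a)))" if "\<theta> \<notin># A" for A
    using that by (induction A) (auto simp: zero_top_def Value_finite_part simp flip: Value_add)
  moreover have "\<theta> \<notin># roots f"
    using assms \<open>f \<noteq> 0\<close> by (simp add: set_roots)
  ultimately show ?thesis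
    using assms by (simp add: root_valuation_eq_sum[OF \<open>f \<noteq> 0\<close>] monic_def)
qed

text \<open>
  Both weights are averages over the orbit of \<open>(\<alpha>, \<beta>)\<close> under the automorphism group, so they can
  be compared termwise.
\<close>

lemma wt_le_by_conjugates:
  assumes p: "monic p" "irreducible p" "poly (map_poly to_ac p) \<theta> \<noteq> 0" "\<alpha> \<in># roots p"
    and q: "monic q" "irreducible q" "poly (map_poly to_ac q) \<theta> \<noteq> 0" "\<beta> \<in># roots q"
    and le: "\<And>\<sigma>. closure_aut \<sigma> \<Longrightarrow> w (\<theta> - \<sigma> \<alpha>) \<le> w (\<theta> - \<sigma> \<beta>)"
  shows "wt (root_valuation v \<theta>) p \<le> wt (root_valuation v \<theta>) q"
    and "w (\<theta> - \<alpha>) < w (\<theta> - \<beta>) \<Longrightarrow> wt (root_valuation v \<theta>) p < wt (root_valuation v \<theta>) q"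
proof -
  define f where "f x = finite_part (w (\<theta> - x))" for x
  define P where "P = conjugate_pairs \<alpha> \<beta>"
  define sp sq where "sp = (\<Sum>x\<in>#roots p. f x)" and "sq = (\<Sum>x\<in>#roots q. f x)"
  have nz: "p \<noteq> 0" "q \<noteq> 0"
    using p(1) q(1) by (simp_all add: monic_nonzero)
  have deg: "degree p > 0" "degree q > 0"
    using p(4) q(4) map_poly_to_ac_factor(2)[OF nz(1)] map_poly_to_ac_factor(2)[OF nz(2)]
    by (metis gr0I size_eq_0_iff_empty empty_not_add_mset mset_add)+
  have fin: "finite P"
    unfolding P_def using finite_conjugate_pairs nz p q by blast
  have "(\<alpha>, \<beta>) \<in> P"
    unfolding P_def conjugate_pairs_def using closure_aut_id by (metis (mono_tags, lifting) CollectI id_apply)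
  then have card: "card P > 0"
    using fin by (auto simp: card_gt_0_iff)
  have rt: "\<theta> - fst z \<noteq> 0 \<and> \<theta> - snd z \<noteq> 0 \<and> w (\<theta> - fst z) \<le> w (\<theta> - snd z)" if "z \<in> P" for z
  proof -
    obtain \<sigma> where \<sigma>: "closure_aut \<sigma>" "z = (\<sigma> \<alpha>, \<sigma> \<beta>)"
      using \<open>z \<in> P\<close> by (auto simp: P_def conjugate_pairs_def)
    then have "\<sigma> \<alpha> \<in># roots p" "\<sigma> \<beta> \<in># roots q"
      using closure_aut_roots nz p(4) q(4) by blast+
    then show ?thesis
      using \<sigma> le p(3) q(3) nz by (auto simp: set_roots)
  qed
  have le_f: "f (fst z) \<le> f (snd z)" if "z \<in> P" for z
    using rt[OF that] unfolding f_def
    by (metis Value_finite_part less_eq_top_Value_Value w_eq_Top_iff)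
  have sums: "nat_mult (card P) sp = nat_mult (degree p) (\<Sum>z\<in>P. f (fst z))"
    "nat_mult (card P) sq = nat_mult (degree q) (\<Sum>z\<in>P. f (snd z))"
  proof -
    show "nat_mult (card P) sp = nat_mult (degree p) (\<Sum>z\<in>P. f (fst z))"
      unfolding P_def sp_def using p q nz by (intro sum_conjugate_pairs) auto
    have "nat_mult (card (conjugate_pairs \<beta> \<alpha>)) sq = nat_mult (degree q) (\<Sum>z\<in>conjugate_pairs \<beta> \<alpha>. f (fst z))"
      unfolding P_def sq_def using p q nz by (intro sum_conjugate_pairs) auto
    then show "nat_mult (card P) sq = nat_mult (degree q) (\<Sum>z\<in>P. f (snd z))"
      unfolding P_def conjugate_pairs_swap[of \<alpha> \<beta>, symmetric]
      by (simp add: card_image sum.reindex)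
  qed
  have val: "root_valuation v \<theta> p = Value sp" "root_valuation v \<theta> q = Value sq"
    unfolding sp_def sq_def f_def using p q by (auto intro: root_valuation_monic)
  have wt_le: "Value (hull_div sp (degree p)) \<le> Value (hull_div sq (degree q)) \<longleftrightarrow>
      (\<Sum>z\<in>P. f (fst z)) \<le> (\<Sum>z\<in>P. f (snd z))"
    "Value (hull_div sq (degree q)) \<le> Value (hull_div sp (degree p)) \<longleftrightarrow>
      (\<Sum>z\<in>P. f (snd z)) \<le> (\<Sum>z\<in>P. f (fst z))"
  proof -
    \<comment> \<open>Clearing denominators: the two weights become the two orbit sums, up to the
      positive factors \<open>card P\<close> and \<open>degree p * degree q\<close>.\<close>
    have eq: "nat_mult (card P) (nat_mult (degree q) sp) = nat_mult (degree p * degree q) (\<Sum>z\<in>P. f (fst z))"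
      "nat_mult (card P) (nat_mult (degree p) sq) = nat_mult (degree p * degree q) (\<Sum>z\<in>P. f (snd z))"
      unfolding nat_mult_left_commute[of "card P"] sums by (simp_all add: nat_mult_assoc mult.commute)
    show "Value (hull_div sp (degree p)) \<le> Value (hull_div sq (degree q)) \<longleftrightarrow>
      (\<Sum>z\<in>P. f (fst z)) \<le> (\<Sum>z\<in>P. f (snd z))"
      using nat_mult_le_iff[OF card, of "nat_mult (degree q) sp" "nat_mult (degree p) sq"] deg
      by (simp add: hull_div_le_iff eq nat_mult_le_iff)
    show "Value (hull_div sq (degree q)) \<le> Value (hull_div sp (degree p)) \<longleftrightarrow>
      (\<Sum>z\<in>P. f (snd z)) \<le> (\<Sum>z\<in>P. f (fst z))"
      using nat_mult_le_iff[OF card, of "nat_mult (degree p) sq" "nat_mult (degree q) sp"] deg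
      by (simp add: hull_div_le_iff eq nat_mult_le_iff)
  qed
  show "wt (root_valuation v \<theta>) p \<le> wt (root_valuation v \<theta>) q"
    using wt_le(1) le_f by (simp add: wt_def val sum_mono)
  assume "w (\<theta> - \<alpha>) < w (\<theta> - \<beta>)"
  then have "f \<alpha> < f \<beta>"
    using rt[OF \<open>(\<alpha>, \<beta>) \<in> P\<close>] unfolding f_def
    by (metis Value_finite_part fst_conv less_top_Value snd_conv w_eq_Top_iff)
  then have "(\<Sum>z\<in>P. f (fst z)) < (\<Sum>z\<in>P. f (snd z))"
    using \<open>(\<alpha>, \<beta>) \<in> P\<close> le_f fin by (intro sum_strict_mono_ex1) force+
  then show "wt (root_valuation v \<theta>) p < wt (root_valuation v \<theta>) q"
    using wt_le(2) by (simp add: wt_def val flip: not_le)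
qed

text \<open>With \<alpha> nearest to \<theta> and \<beta> at least as near, the ultrametric
  inequality gives \<open>w (\<theta> - \<sigma> \<alpha>) \<le> w (\<alpha> - \<beta>) = w
  (\<sigma> \<alpha> - \<sigma> \<beta>)\<close>, so \<open>\<sigma> \<beta>\<close> is at least as
  near to \<theta> as \<open>\<sigma> \<alpha>\<close>. This is the termwise hypothesis on all
  conjugates.\<close>

lemma wt_le_by_root_distance:
  assumes p: "monic p" "irreducible p" "poly (map_poly to_ac p) \<theta> \<noteq> 0" "\<alpha> \<in># roots p"
    and q: "monic q" "irreducible q" "poly (map_poly to_ac q) \<theta> \<noteq> 0" "\<beta> \<in># roots q"
    and nearest: "\<And>\<alpha>'. \<alpha>' \<in># roots p \<Longrightarrow> w (\<theta> - \<alpha>') \<le> w (\<theta> - \<alpha>)"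
    and le: "w (\<theta> - \<alpha>) \<le> w (\<theta> - \<beta>)"
  shows "wt (root_valuation v \<theta>) p \<le> wt (root_valuation v \<theta>) q"
    and "w (\<theta> - \<alpha>) < w (\<theta> - \<beta>) \<Longrightarrow> wt (root_valuation v \<theta>) p < wt (root_valuation v \<theta>) q"
proof -
  have "w (\<theta> - \<sigma> \<alpha>) \<le> w (\<theta> - \<sigma> \<beta>)" if \<sigma>: "closure_aut \<sigma>" for \<sigma>
  proof -
    have "\<sigma> \<alpha> \<in># roots p"
      by (rule closure_aut_roots[OF \<sigma> monic_nonzero[OF p(1)] p(4)])
    then have 1: "w (\<theta> - \<sigma> \<alpha>) \<le> w (\<theta> - \<alpha>)"
      by (rule nearest)
    also have "\<dots> \<le> w (\<alpha> - \<beta>)"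
      using w.v_diff_ge[of _ "\<theta> - \<beta>" "\<theta> - \<alpha>"] le by simp
    also have "\<dots> = w (\<sigma> \<alpha> - \<sigma> \<beta>)"
      using w_closure_aut[OF \<sigma>, of "\<alpha> - \<beta>"] \<sigma> ring_hom_fun.hom_diff[of \<sigma> \<alpha> \<beta>]
      by (simp add: closure_aut_def)
    finally show ?thesis
      using w.v_add_ge[of _ "\<theta> - \<sigma> \<alpha>" "\<sigma> \<alpha> - \<sigma> \<beta>"] by simp
  qed
  note conjugates = wt_le_by_conjugates[OF p q this]
  show "wt (root_valuation v \<theta>) p \<le> wt (root_valuation v \<theta>) q"
    by (rule conjugates(1))
  show "wt (root_valuation v \<theta>) p < wt (root_valuation v \<theta>) q" if "w (\<theta> - \<alpha>) < w (\<theta> - \<beta>)"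
    by (rule conjugates(2)[OF _ that])
qed

end

subsection \<open>Gauss valuations\<close>

definition gauss_term ::
    "('r::comm_ring_1 \<Rightarrow> 'h::linordered_ab_group_add top) \<Rightarrow> 'h \<Rightarrow> 'r poly \<Rightarrow> nat \<Rightarrow> 'h top" where
  "gauss_term v \<delta> f i = v (coeff f i) + Value (nat_mult i \<delta>)"

text \<open>Indices above the degree would only contribute \<open>Top\<close>, so the minimum in
  effect runs over all indices (\<open>le_gauss_iff\<close>); the zero polynomial gets
  \<open>Top\<close> from index 0.\<close>

definition gauss ::
    "('r::comm_ring_1 \<Rightarrow> 'h::linordered_ab_group_add top) \<Rightarrow> 'h \<Rightarrow> 'r poly \<Rightarrow> 'h top" where
  "gauss v \<delta> f = Min (gauss_term v \<delta> f ` {..degree f})"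

context valued_ring
begin

lemma le_gauss_iff: "a \<le> gauss v \<delta> f \<longleftrightarrow> (\<forall>i. a \<le> gauss_term v \<delta> f i)"
proof
  assume *: "a \<le> gauss v \<delta> f"
  show "\<forall>i. a \<le> gauss_term v \<delta> f i"
  proof
    fix i show "a \<le> gauss_term v \<delta> f i"
      using * by (cases "i \<le> degree f") (auto simp: gauss_def gauss_term_def coeff_eq_0)
  qed
qed (auto simp: gauss_def)

lemma gauss_attained: "\<exists>i. gauss_term v \<delta> f i = gauss v \<delta> f"
proof -
  have "gauss v \<delta> f \<in> gauss_term v \<delta> f ` {..degree f}"
    unfolding gauss_def by (rule Min_in) auto
  then show ?thesis
    by (metis image_iff)
qed

lemma gauss_le: "gauss v \<delta> f \<le> gauss_term v \<delta> f i"
  using le_gauss_iff by blast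

lemma gauss_add: "min (gauss v \<delta> f) (gauss v \<delta> g) \<le> gauss v \<delta> (f + g)"
  unfolding le_gauss_iff
proof
  fix i
  have "min (gauss v \<delta> f) (gauss v \<delta> g) \<le> min (gauss_term v \<delta> f i) (gauss_term v \<delta> g i)"
    using gauss_le[of \<delta> f i] gauss_le[of \<delta> g i] by (meson min.mono)
  also have "\<dots> \<le> min (v (coeff f i)) (v (coeff g i)) + Value (nat_mult i \<delta>)"
    by (auto simp: gauss_term_def min_def)
  also have "\<dots> \<le> gauss_term v \<delta> (f + g) i"
    unfolding gauss_term_def coeff_add by (rule add_right_mono) (rule v_add)
  finally show "min (gauss v \<delta> f) (gauss v \<delta> g) \<le> gauss_term v \<delta> (f + g) i" .
qed

lemma gauss_term_mult:
  assumes "j \<le> i"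
  shows "v (coeff f j * coeff g (i - j)) + Value (nat_mult i \<delta>) = gauss_term v \<delta> f j + gauss_term v \<delta> g (i - j)"
proof -
  have "nat_mult i \<delta> = nat_mult j \<delta> + nat_mult (i - j) \<delta>"
    using assms by (simp flip: nat_mult_add_left)
  then show ?thesis
    by (simp add: gauss_term_def v_mult add_ac flip: Value_add)
qed

lemma le_add_Value_iff:
  fixes x y :: "'h top" shows "x \<le> y + Value d \<longleftrightarrow> x + Value (- d) \<le> y"
  by (cases x; cases y) (auto simp: algebra_simps)

lemma less_add_Value_iff:
  fixes x y :: "'h top" shows "x < y + Value d \<longleftrightarrow> x + Value (- d) < y"
  by (cases x; cases y) (auto simp: algebra_simps)

lemma gauss_mult_le: "gauss v \<delta> f + gauss v \<delta> g \<le> gauss v \<delta> (f * g)"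
  unfolding le_gauss_iff
proof
  fix i
  show "gauss v \<delta> f + gauss v \<delta> g \<le> gauss_term v \<delta> (f * g) i"
    unfolding gauss_term_def le_add_Value_iff coeff_mult
  proof (rule v_sum_ge)
    fix j assume "j \<in> {..i}"
    then show "gauss v \<delta> f + gauss v \<delta> g + Value (- nat_mult i \<delta>) \<le> v (coeff f j * coeff g (i - j))"
      using gauss_term_mult[of j i f g \<delta>] add_mono[OF gauss_le[of \<delta> f j] gauss_le[of \<delta> g "i - j"]]
      by (simp flip: le_add_Value_iff)
  qed
qed

text \<open>Gauss's lemma. If \<open>j\<close> and \<open>k\<close> are the least indices at which
  the minima for \<open>f\<close> and \<open>g\<close> are attained, then among the products
  contributing to the coefficient at \<open>j + k\<close> the one at \<open>j\<close>,
  \<open>k\<close> has strictly smallest value, so it cannot cancel.\<close>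

lemma gauss_mult: "gauss v \<delta> (f * g) = gauss v \<delta> f + gauss v \<delta> g"
proof (cases "gauss v \<delta> f = Top \<or> gauss v \<delta> g = Top")
  case True
  then show ?thesis
    using gauss_mult_le[of \<delta> f g] by (auto simp: less_eq_top_is_Top)
next
  case False
  let ?A = "gauss v \<delta> f" and ?B = "gauss v \<delta> g"
  define j k where "j = (LEAST i. gauss_term v \<delta> f i = ?A)" and "k = (LEAST i. gauss_term v \<delta> g i = ?B)"
  have j: "gauss_term v \<delta> f j = ?A" and k: "gauss_term v \<delta> g k = ?B"
    unfolding j_def k_def using gauss_attained by (metis (mono_tags, lifting) LeastI_ex)+
  have less_j: "?A < gauss_term v \<delta> f i" if "i < j" for i
    using not_less_Least[of i "\<lambda>i. gauss_term v \<delta> f i = ?A"] that gauss_le[of \<delta> f i]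
    by (auto simp: j_def)
  have less_k: "?B < gauss_term v \<delta> g i" if "i < k" for i
    using not_less_Least[of i "\<lambda>i. gauss_term v \<delta> g i = ?B"] that gauss_le[of \<delta> g i]
    by (auto simp: k_def)
  define n where "n = j + k"
  let ?r = "\<Sum>i\<in>{..n} - {j}. coeff f i * coeff g (n - i)"
  have top: "v (coeff f j * coeff g k) + Value (nat_mult n \<delta>) = ?A + ?B"
    using gauss_term_mult[of j n f g \<delta>] j k by (simp add: n_def)
  have "?A + ?B + Value (- nat_mult n \<delta>) < v ?r"
  proof (rule v_sum_gt)
    show "?A + ?B + Value (- nat_mult n \<delta>) \<noteq> Top"
      using False by (auto simp: add_eq_Top_iff)
  next
    fix i assume i: "i \<in> {..n} - {j}"
    have "?A + ?B < gauss_term v \<delta> f i + gauss_term v \<delta> g (n - i)"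
    proof (cases "i < j")
      case True
      then show ?thesis
        using top_add_le_less_mono[OF gauss_le[of \<delta> g "n - i"] _ less_j[of i]] False by (simp add: add.commute)
    next
      case ge: False
      then have "n - i < k"
        using i by (auto simp: n_def)
      then show ?thesis
        using top_add_le_less_mono[OF gauss_le[of \<delta> f i] _ less_k[of "n - i"]] False by simp
    qed
    then show "?A + ?B + Value (- nat_mult n \<delta>) < v (coeff f i * coeff g (n - i))"
      using i gauss_term_mult[of i n f g \<delta>] by (simp flip: less_add_Value_iff)
  qed
  then have "v (coeff f j * coeff g k) < v ?r"
    unfolding top[symmetric] by (cases "v (coeff f j * coeff g k)"; cases "v ?r") auto
  moreover have "coeff (f * g) n = coeff f j * coeff g k + ?r"
    unfolding coeff_mult by (subst sum.remove[of _ j]) (auto simp: n_def)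
  ultimately have "v (coeff (f * g) n) = v (coeff f j * coeff g k)"
    by (simp add: v_add_eq)
  then have "gauss_term v \<delta> (f * g) n = ?A + ?B"
    using top by (simp add: gauss_term_def)
  then show ?thesis
    using gauss_le[of \<delta> "f * g" n] gauss_mult_le[of \<delta> f g] by simp
qed

lemma gauss_const [simp]: "gauss v \<delta> [:c:] = v c"
  by (simp add: gauss_def gauss_term_def flip: zero_top_def)

lemma gauss_linear: "gauss v \<delta> [:c, 1:] = min (v c) (Value \<delta>)"
proof -
  have "{..Suc 0} = {0, Suc 0}" by auto
  then show ?thesis
    by (simp add: gauss_def gauss_term_def zero_top_def[symmetric])
qed

lemma valuation_gauss: "valuation (gauss v \<delta>)"
  unfolding valuation_def
  using gauss_const[of \<delta> 1] gauss_const[of \<delta> 0] gauss_add gauss_mult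
  by (simp add: one_pCons del: gauss_const)

end

lemma valuation_comp_hom:
  assumes "valuation v" "ring_hom_fun h"
  shows "valuation (\<lambda>x. v (h x))"
proof -
  interpret ring_hom_fun h by fact
  show ?thesis
    using assms(1) by (simp add: valuation_def hom_0 hom_1 hom_add hom_mult)
qed

text \<open>Composition with \<open>[:\<alpha>, 1:]\<close> produces the Taylor coefficients of
  \<open>f\<close> at \<alpha>; this is the monomial valuation in powers of
  \<open>X - \<alpha>\<close> with radius \<delta>.\<close>

definition gauss_at ::
    "('r::comm_ring_1 \<Rightarrow> 'h::linordered_ab_group_add top) \<Rightarrow> 'r \<Rightarrow> 'h \<Rightarrow> 'r poly \<Rightarrow> 'h top" where
  "gauss_at v \<alpha> \<delta> f = gauss v \<delta> (pcompose f [:\<alpha>, 1:])"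

context valued_ring
begin

lemma valuation_gauss_at: "valuation (gauss_at v \<alpha> \<delta>)"
  unfolding gauss_at_def
  by (intro valuation_comp_hom[OF valuation_gauss])
    (unfold_locales, auto simp: pcompose_add pcompose_mult pcompose_1)

lemma gauss_at_const [simp]: "gauss_at v \<alpha> \<delta> [:c:] = v c"
  by (simp add: gauss_at_def)

lemma gauss_at_linear: "gauss_at v \<alpha> \<delta> [:- \<beta>, 1:] = min (v (\<alpha> - \<beta>)) (Value \<delta>)"
  by (simp add: gauss_at_def pcompose_pCons gauss_linear)

lemma gauss_at_le_v_poly_centre: "gauss_at v \<alpha> \<delta> f \<le> v (poly f \<alpha>)"
proof -
  have "coeff (pcompose f [:\<alpha>, 1:]) 0 = poly f \<alpha>"
    by (simp add: pcompose_coeff_0)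
  then show ?thesis
    using gauss_le[of \<delta> "pcompose f [:\<alpha>, 1:]" 0] by (simp add: gauss_at_def gauss_term_def flip: zero_top_def)
qed

end

subsection \<open>Expansions\<close>

text \<open>Lowest digit and tail of an expansion are recovered by division, which yields uniqueness
  digit by digit.\<close>

lemma expansion_pCons_mod_div:
  fixes a :: "'k::field poly poly"
  assumes "degree r < degree g"
  shows "poly (pCons r a) g mod g = r" and "poly (pCons r a) g div g = poly a g"
proof -
  have "r div g = 0"
    using assms by (simp add: div_poly_less)
  moreover have "g \<noteq> 0"
    using assms by auto
  ultimately show "poly (pCons r a) g mod g = r" "poly (pCons r a) g div g = poly a g"
    using assms by (auto simp: mod_poly_less)
qed

lemma expansion_unique:
  fixes a b :: "'k::field poly poly"
  assumes "\<And>s. degree (coeff a s) < degree g" "\<And>s. degree (coeff b s) < degree g" "poly a g = poly b g"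
  shows "a = b"
  using assms
proof (induction a arbitrary: b)
  case 0
  show ?case
    using 0(2,3)
  proof (induction b)
    case (pCons c b)
    have "degree c < degree g" "\<And>s. degree (coeff b s) < degree g"
      using pCons(3) by (metis coeff_pCons_0, metis coeff_pCons_Suc)
    moreover have "0 = c" "0 = poly b g"
      using expansion_pCons_mod_div[of c g b] pCons(4) calculation by simp_all
    ultimately show ?case
      using pCons(1,2) by auto
  qed simp
next
  case (pCons r a)
  obtain r' b' where b: "b = pCons r' b'"
    by (metis pCons_cases)
  have deg: "degree r < degree g" "\<And>s. degree (coeff a s) < degree g"
    "degree r' < degree g" "\<And>s. degree (coeff b' s) < degree g"
    using pCons(3,4) unfolding b by (metis coeff_pCons_0, metis coeff_pCons_Suc, metis coeff_pCons_0, metis coeff_pCons_Suc)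
  have "r = r'" "poly a g = poly b' g"
    using expansion_pCons_mod_div[OF deg(1), of a] expansion_pCons_mod_div[OF deg(3), of b'] pCons(5)
    unfolding b by simp_all
  then show ?case
    using pCons(2)[OF deg(2,4)] by (simp add: b)
qed

lemma expansion_exists:
  fixes f g :: "'k::field poly"
  assumes "0 < degree g"
  shows "\<exists>a. (\<forall>s. degree (coeff a s) < degree g) \<and> poly a g = f"
proof (induction "degree f" arbitrary: f rule: less_induct)
  case less
  have g: "g \<noteq> 0" "f mod g = 0 \<or> degree (f mod g) < degree g"
    using assms degree_mod_less[of g f] by (metis degree_0 less_numeral_extra(3))+
  then have mod: "degree (f mod g) < degree g"
    using assms by auto
  show ?case
  proof (cases "degree f < degree g")
    case True
    then show ?thesis
      using assms by (intro exI[of _ "[:f:]"]) (auto simp: coeff_pCons split: nat.splits)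
  next
    case False
    then have "degree (f div g) < degree f"
      using assms by (intro degree_div_less) auto
    then obtain a where a: "\<And>s. degree (coeff a s) < degree g" "poly a g = f div g"
      using less by blast
    then show ?thesis
      using mod by (intro exI[of _ "pCons (f mod g) a"]) (auto simp: coeff_pCons mult.commute split: nat.splits)
  qed
qed

lemma
  fixes f g :: "'k::field poly"
  assumes "0 < degree g"
  shows degree_coeff_expansion: "degree (coeff (expansion g f) s) < degree g"
    and poly_expansion: "poly (expansion g f) g = f"
proof -
  have "\<exists>!a. (\<forall>s. degree (coeff a s) < degree g) \<and> poly a g = f"
    using expansion_exists[OF assms] expansion_unique by (metis (no_types, lifting))
  from theI'[OF this] show "degree (coeff (expansion g f) s) < degree g" "poly (expansion g f) g = f"
    by (simp_all add: expansion_def)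
qed

lemma le_truncation_iff:
  fixes \<mu> :: "'k::field poly \<Rightarrow> 'h::linordered_ab_group_add top"
  assumes "\<mu> 0 = Top"
  shows "c \<le> truncation \<mu> g f \<longleftrightarrow> (\<forall>s. c \<le> \<mu> (coeff (expansion g f) s * g ^ s))"
proof
  assume *: "c \<le> truncation \<mu> g f"
  show "\<forall>s. c \<le> \<mu> (coeff (expansion g f) s * g ^ s)"
  proof
    fix s show "c \<le> \<mu> (coeff (expansion g f) s * g ^ s)"
      using * assms by (cases "s \<le> degree (expansion g f)") (auto simp: truncation_def coeff_eq_0)
  qed
qed (auto simp: truncation_def)

subsection \<open>The graded algebra\<close>

abbreviation (input) "lookup \<equiv> Poly_Mapping.lookup"
abbreviation (input) "keys \<equiv> Poly_Mapping.keys"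

context valued_ring
begin

section \<open>Cosets and their representatives\<close>

abbreviation "gr \<equiv> graded_algebra v"

lemma coset_eq_iff: "x +o P_gt v \<alpha> = y +o P_gt v \<alpha> \<longleftrightarrow> Value \<alpha> < v (x - y)"
proof
  assume "x +o P_gt v \<alpha> = y +o P_gt v \<alpha>"
  moreover have "x \<in> x +o P_gt v \<alpha>"
    by (auto simp: elt_set_plus_def P_gt_def)
  ultimately show "Value \<alpha> < v (x - y)"
    by (auto simp: elt_set_plus_def P_gt_def)
next
  assume *: "Value \<alpha> < v (x - y)"
  have "y +o P_gt v \<alpha> \<subseteq> x +o P_gt v \<alpha>" if "Value \<alpha> < v (x - y)" for x y
  proof
    fix z assume "z \<in> y +o P_gt v \<alpha>"
    then obtain e where e: "z = y + e" "Value \<alpha> < v e"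
      by (auto simp: elt_set_plus_def P_gt_def)
    have "Value \<alpha> < v (e - (x - y))"
      by (rule v_diff_gt[OF e(2) that])
    then have "e - (x - y) \<in> P_gt v \<alpha>"
      by (simp add: P_gt_def)
    moreover have "z = x + (e - (x - y))"
      using e by simp
    ultimately show "z \<in> x +o P_gt v \<alpha>"
      by blast
  qed
  from this[OF *] this[of y x] * show "x +o P_gt v \<alpha> = y +o P_gt v \<alpha>"
    by (auto simp: v_diff_commute)
qed

lemma coset_eq_P_gt_iff: "x +o P_gt v \<alpha> = P_gt v \<alpha> \<longleftrightarrow> Value \<alpha> < v x"
  using coset_eq_iff[of x \<alpha> 0] by simp

lemma P_gt_add: "P_gt v \<alpha> + P_gt v \<alpha> = P_gt v \<alpha>"
proof
  show "P_gt v \<alpha> + P_gt v \<alpha> \<subseteq> P_gt v \<alpha>"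
    by (auto simp: P_gt_def set_plus_def intro: v_add_gt)
  show "P_gt v \<alpha> \<subseteq> P_gt v \<alpha> + P_gt v \<alpha>"
    by (rule set_zero_plus2) (simp add: P_gt_def)
qed

text \<open>
  The graded algebra is a quotient of a subring of the group ring \<open>'r['h]\<close>, which supplies its
  ring axioms.
\<close>

definition reps :: "('h \<Rightarrow>\<^sub>0 'r) set" where
  "reps = {p. \<forall>\<alpha>. Value \<alpha> \<le> v (lookup p \<alpha>)}"

definition cls :: "('h \<Rightarrow>\<^sub>0 'r) \<Rightarrow> 'h \<Rightarrow> 'r set" where
  "cls p = (\<lambda>\<alpha>. lookup p \<alpha> +o P_gt v \<alpha>)"

lemma repsD: "p \<in> reps \<Longrightarrow> Value \<alpha> \<le> v (lookup p \<alpha>)"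
  by (simp add: reps_def)

lemma lookup_times:
  fixes p q :: "'h \<Rightarrow>\<^sub>0 'r"
  shows "lookup (p * q) \<gamma> = (\<Sum>\<alpha>\<in>keys p. lookup p \<alpha> * lookup q (\<gamma> - \<alpha>))"
proof -
  have "(\<Sum>\<beta>. lookup q \<beta> when \<gamma> = \<alpha> + \<beta>) = lookup q (\<gamma> - \<alpha>)" for \<alpha>
  proof -
    have "(\<gamma> = \<alpha> + \<beta>) = (\<beta> = \<gamma> - \<alpha>)" for \<beta>
      by (auto simp: eq_diff_eq add.commute)
    then show ?thesis
      by (simp only: Sum_any_when_equal)
  qed
  then have "lookup (p * q) \<gamma> = (\<Sum>\<alpha>. lookup p \<alpha> * lookup q (\<gamma> - \<alpha>))"
    by (simp add: lookup_mult)
  also have "\<dots> = (\<Sum>\<alpha>\<in>keys p. lookup p \<alpha> * lookup q (\<gamma> - \<alpha>))"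
    by (rule Sum_any.expand_superset) (auto simp: in_keys_iff)
  finally show ?thesis .
qed

lemma lookup_single_times:
  fixes q :: "'h \<Rightarrow>\<^sub>0 'r"
  shows "lookup (Poly_Mapping.single \<beta> x * q) \<gamma> = x * lookup q (\<gamma> - \<beta>)"
  by (cases "x = 0") (simp_all add: lookup_times)

lemma Value_le_times:
  assumes "Value \<alpha> \<le> v x" "Value (\<gamma> - \<alpha>) \<le> v y"
  shows "Value \<gamma> \<le> v (x * y)"
  using add_mono[OF assms] by (simp add: v_mult)

lemma Value_less_times:
  assumes "Value \<alpha> < v x" "Value (\<gamma> - \<alpha>) \<le> v y"
  shows "Value \<gamma> < v (x * y)"
  using top_add_le_less_mono[OF assms(2) _ assms(1)] by (simp add: v_mult add.commute)

lemma Value_less_times':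
  assumes "Value \<alpha> \<le> v x" "Value (\<gamma> - \<alpha>) < v y"
  shows "Value \<gamma> < v (x * y)"
  using top_add_le_less_mono[OF assms(1) _ assms(2)] by (simp add: v_mult add.commute)

lemma reps_add: "p \<in> reps \<Longrightarrow> q \<in> reps \<Longrightarrow> p + q \<in> reps"
  by (auto simp: reps_def lookup_add intro: v_add_ge)

lemma reps_uminus: "p \<in> reps \<Longrightarrow> - p \<in> reps"
  by (simp add: reps_def)

lemma reps_zero: "0 \<in> reps"
  by (simp add: reps_def)

lemma reps_times: "p \<in> reps \<Longrightarrow> q \<in> reps \<Longrightarrow> p * q \<in> reps"
  unfolding reps_def by (auto simp: lookup_times intro!: v_sum_ge Value_le_times)

lemma reps_single: "Value \<alpha> \<le> v x \<Longrightarrow> Poly_Mapping.single \<alpha> x \<in> reps"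
  by (auto simp: reps_def lookup_single when_def)

lemma reps_one: "1 \<in> reps"
  using reps_single[of 0 1] by (simp add: zero_top_def)

lemma cls_eq_iff: "cls p = cls q \<longleftrightarrow> (\<forall>\<alpha>. Value \<alpha> < v (lookup p \<alpha> - lookup q \<alpha>))"
  by (simp add: cls_def fun_eq_iff coset_eq_iff)

lemma carrier_gr: "carrier gr = cls ` reps"
proof
  show "cls ` reps \<subseteq> carrier gr"
  proof
    fix u assume "u \<in> cls ` reps"
    then obtain p where p: "p \<in> reps" "u = cls p" by blast
    have "{\<alpha>. u \<alpha> \<noteq> P_gt v \<alpha>} \<subseteq> keys p"
      by (auto simp: p cls_def in_keys_iff)
    then have "finite {\<alpha>. u \<alpha> \<noteq> P_gt v \<alpha>}"
      by (rule finite_subset) simp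
    then show "u \<in> carrier gr"
      using p repsD by (auto simp: graded_algebra_def P_ge_def cls_def)
  qed
  show "carrier gr \<subseteq> cls ` reps"
  proof
    fix u assume "u \<in> carrier gr"
    then have u: "\<And>\<alpha>. \<exists>g\<in>P_ge v \<alpha>. u \<alpha> = g +o P_gt v \<alpha>" "finite {\<alpha>. u \<alpha> \<noteq> P_gt v \<alpha>}"
      by (auto simp: graded_algebra_def)
    then obtain g where g: "\<And>\<alpha>. g \<alpha> \<in> P_ge v \<alpha>" "\<And>\<alpha>. u \<alpha> = g \<alpha> +o P_gt v \<alpha>"
      by metis
    \<comment> \<open>Zero classes get the representative 0 itself, since otherwise the support
      could be infinite.\<close>
    define p where "p = Abs_poly_mapping (\<lambda>\<alpha>. if u \<alpha> = P_gt v \<alpha> then 0 else g \<alpha>)"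
    have "finite {\<alpha>. (if u \<alpha> = P_gt v \<alpha> then 0 else g \<alpha>) \<noteq> 0}"
      by (rule finite_subset[OF _ u(2)]) auto
    then have p: "lookup p \<alpha> = (if u \<alpha> = P_gt v \<alpha> then 0 else g \<alpha>)" for \<alpha>
      unfolding p_def by (subst lookup_Abs_poly_mapping) simp_all
    have "p \<in> reps"
      using g(1) by (auto simp: reps_def p P_ge_def)
    moreover have "u = cls p"
      using g(2) by (auto simp: cls_def p fun_eq_iff)
    ultimately show "u \<in> cls ` reps"
      by blast
  qed
qed

lemma cls_add: "cls p \<oplus>\<^bsub>gr\<^esub> cls q = cls (p + q)"
  by (simp add: graded_algebra_def cls_def lookup_add set_plus_rearrange P_gt_add)

lemma cls_zero: "\<zero>\<^bsub>gr\<^esub> = cls 0"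
  by (simp add: graded_algebra_def cls_def)

lemma initial_form_eq_cls: "v x = Value \<alpha> \<Longrightarrow> initial_form v x = cls (Poly_Mapping.single \<alpha> x)"
  by (auto simp: initial_form_def cls_def fun_eq_iff lookup_single when_def)

lemma cls_one: "\<one>\<^bsub>gr\<^esub> = cls 1"
  using initial_form_eq_cls[of 1 0] by (simp add: graded_algebra_def zero_top_def)

text \<open>The elementwise product of two cosets need not be a full coset: it only lies in one and
  contains a representative of it. The summand \<open>P_gt v \<gamma>\<close> fills the sum up to a
  full coset.\<close>

lemma sum_cosets:
  assumes "finite N" "\<And>\<alpha>. \<alpha> \<in> N \<Longrightarrow> b \<alpha> \<in> B \<alpha> \<and> B \<alpha> \<subseteq> b \<alpha> +o P_gt v \<gamma>"
  shows "P_gt v \<gamma> + sum B N = sum b N +o P_gt v \<gamma>"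
  using assms
proof (induction N)
  case empty
  then show ?case by simp
next
  case (insert a N)
  have "P_gt v \<gamma> + sum B (insert a N) = B a + (P_gt v \<gamma> + sum B N)"
    using insert(1,2) by (simp add: add_ac)
  also have "\<dots> = B a + (sum b N +o P_gt v \<gamma>)"
    using insert by simp
  also have "\<dots> = (b a + sum b N) +o P_gt v \<gamma>"
  proof
    have "B a + (sum b N +o P_gt v \<gamma>) \<subseteq> (b a +o P_gt v \<gamma>) + (sum b N +o P_gt v \<gamma>)"
      using insert(4) by (intro set_plus_mono2) auto
    then show "B a + (sum b N +o P_gt v \<gamma>) \<subseteq> (b a + sum b N) +o P_gt v \<gamma>"
      by (simp add: set_plus_rearrange P_gt_add)
    have "b a +o (sum b N +o P_gt v \<gamma>) \<subseteq> B a + (sum b N +o P_gt v \<gamma>)"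
      using insert(4) by (intro set_plus_mono3) auto
    then show "(b a + sum b N) +o P_gt v \<gamma> \<subseteq> B a + (sum b N +o P_gt v \<gamma>)"
      by (simp add: set_plus_rearrange2)
  qed
  finally show ?case
    using insert(1,2) by simp
qed

lemma cls_mult:
  assumes "p \<in> reps" "q \<in> reps"
  shows "cls p \<otimes>\<^bsub>gr\<^esub> cls q = cls (p * q)"
proof
  fix \<gamma>
  \<comment> \<open>The product of the graded algebra sums over nonzero classes only, that of the
    group ring over all keys; the difference lies in \<open>P_gt v \<gamma>\<close>.\<close>
  define N where "N = {\<alpha>. cls p \<alpha> \<noteq> P_gt v \<alpha>}"
  have N: "\<alpha> \<in> N \<longleftrightarrow> \<not> Value \<alpha> < v (lookup p \<alpha>)" for \<alpha>
    by (simp add: N_def cls_def coset_eq_P_gt_iff)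
  have N_sub: "N \<subseteq> keys p"
    by (auto simp: N in_keys_iff)
  have "(cls p \<otimes>\<^bsub>gr\<^esub> cls q) \<gamma> = P_gt v \<gamma> + (\<Sum>\<alpha>\<in>N. cls p \<alpha> * cls q (\<gamma> - \<alpha>))"
    by (simp add: graded_algebra_def N_def)
  also have "\<dots> = (\<Sum>\<alpha>\<in>N. lookup p \<alpha> * lookup q (\<gamma> - \<alpha>)) +o P_gt v \<gamma>"
  proof (rule sum_cosets)
    show "finite N"
      using N_sub by (rule finite_subset) simp
    fix \<alpha>
    have 0: "0 \<in> P_gt v \<beta>" for \<beta>
      by (simp add: P_gt_def)
    have "cls p \<alpha> * cls q (\<gamma> - \<alpha>) \<subseteq> lookup p \<alpha> * lookup q (\<gamma> - \<alpha>) +o P_gt v \<gamma>"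
    proof
      fix z assume "z \<in> cls p \<alpha> * cls q (\<gamma> - \<alpha>)"
      then obtain d e where z: "z = (lookup p \<alpha> + d) * (lookup q (\<gamma> - \<alpha>) + e)"
        and de: "Value \<alpha> < v d" "Value (\<gamma> - \<alpha>) < v e"
        by (auto simp: set_times_def cls_def elt_set_plus_def P_gt_def)
      have "Value \<gamma> < v (d * lookup q (\<gamma> - \<alpha>) + (lookup p \<alpha> + d) * e)"
        using de repsD[OF assms(1)] repsD[OF assms(2)]
        by (intro v_add_gt Value_less_times[of \<alpha>] Value_less_times'[of \<alpha>] v_add_ge) auto
      then have "d * lookup q (\<gamma> - \<alpha>) + (lookup p \<alpha> + d) * e \<in> P_gt v \<gamma>"
        by (simp add: P_gt_def)
      moreover have "z = lookup p \<alpha> * lookup q (\<gamma> - \<alpha>) + (d * lookup q (\<gamma> - \<alpha>) + (lookup p \<alpha> + d) * e)"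
        by (simp add: z algebra_simps)
      ultimately show "z \<in> lookup p \<alpha> * lookup q (\<gamma> - \<alpha>) +o P_gt v \<gamma>"
        by blast
    qed
    moreover have "lookup r \<beta> \<in> cls r \<beta>" for r \<beta>
      using set_plus_intro2[OF 0, of "lookup r \<beta>" \<beta>] by (simp add: cls_def)
    ultimately show "lookup p \<alpha> * lookup q (\<gamma> - \<alpha>) \<in> cls p \<alpha> * cls q (\<gamma> - \<alpha>) \<and>
        cls p \<alpha> * cls q (\<gamma> - \<alpha>) \<subseteq> lookup p \<alpha> * lookup q (\<gamma> - \<alpha>) +o P_gt v \<gamma>"
      by blast
  qed
  also have "\<dots> = cls (p * q) \<gamma>"
  proof -
    have "lookup (p * q) \<gamma> = (\<Sum>\<alpha>\<in>N. lookup p \<alpha> * lookup q (\<gamma> - \<alpha>)) + (\<Sum>\<alpha>\<in>keys p - N. lookup p \<alpha> * lookup q (\<gamma> - \<alpha>))"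
      unfolding lookup_times using N_sub by (simp add: sum.subset_diff add.commute)
    moreover have "Value \<gamma> < v (\<Sum>\<alpha>\<in>keys p - N. lookup p \<alpha> * lookup q (\<gamma> - \<alpha>))"
      using repsD[OF assms(2)] by (intro v_sum_gt Value_less_times) (auto simp: N)
    ultimately show ?thesis
      by (simp add: cls_def coset_eq_iff)
  qed
  finally show "(cls p \<otimes>\<^bsub>gr\<^esub> cls q) \<gamma> = cls (p * q) \<gamma>" .
qed

lemma cring_gr: "cring gr"
proof (rule cringI)
  show "abelian_group gr"
  proof (rule abelian_groupI)
    fix x assume "x \<in> carrier gr"
    then obtain p where p: "p \<in> reps" "x = cls p" by (auto simp: carrier_gr)
    have "cls (- p) \<oplus>\<^bsub>gr\<^esub> x = \<zero>\<^bsub>gr\<^esub>"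
      by (simp add: p cls_add cls_zero)
    then show "\<exists>y\<in>carrier gr. y \<oplus>\<^bsub>gr\<^esub> x = \<zero>\<^bsub>gr\<^esub>"
      using p reps_uminus by (auto simp: carrier_gr)
  qed (auto simp: carrier_gr cls_add cls_zero add_ac intro!: imageI reps_add reps_zero)
  show "comm_monoid gr"
    by (rule comm_monoidI)
      (auto simp: carrier_gr cls_mult cls_one mult_ac reps_times reps_one intro!: imageI)
  fix x y z assume "x \<in> carrier gr" "y \<in> carrier gr" "z \<in> carrier gr"
  then obtain p q r where "p \<in> reps" "q \<in> reps" "r \<in> reps" "x = cls p" "y = cls q" "z = cls r"
    by (auto simp: carrier_gr)
  then show "(x \<oplus>\<^bsub>gr\<^esub> y) \<otimes>\<^bsub>gr\<^esub> z = x \<otimes>\<^bsub>gr\<^esub> z \<oplus>\<^bsub>gr\<^esub> y \<otimes>\<^bsub>gr\<^esub> z"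
    by (simp add: cls_add cls_mult reps_add algebra_simps)
qed

section \<open>Initial forms in the graded algebra\<close>

lemma initial_form_in_carrier:
  assumes "v x \<noteq> Top"
  shows "initial_form v x \<in> carrier gr"
  using assms initial_form_eq_cls reps_single[of _ x] by (cases "v x") (auto simp: carrier_gr)

lemma initial_form_unit:
  assumes "v x + v y = 0" "0 < v (x * y - 1)"
  shows "initial_form v x \<otimes>\<^bsub>gr\<^esub> initial_form v y = \<one>\<^bsub>gr\<^esub>"
proof -
  obtain \<alpha> \<beta> where \<alpha>: "v x = Value \<alpha>" "v y = Value \<beta>"
    using assms(1) by (cases "v x"; cases "v y") (auto simp: zero_top_def)
  have 0: "\<alpha> + \<beta> = 0"
    using assms(1) by (simp add: \<alpha> zero_top_def)
  have "initial_form v x \<otimes>\<^bsub>gr\<^esub> initial_form v y = cls (Poly_Mapping.single \<alpha> x * Poly_Mapping.single \<beta> y)"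
    by (simp add: initial_form_eq_cls \<alpha> cls_mult reps_single)
  also have "\<dots> = cls (Poly_Mapping.single 0 (x * y))"
    by (simp add: mult_single 0)
  also have "\<dots> = cls 1"
    using assms(2) by (auto simp: cls_eq_iff lookup_single lookup_one when_def zero_top_def)
  finally show ?thesis
    by (simp add: cls_one)
qed

text \<open>
  In the intended application \<open>v\<close> is the truncation at a polynomial \<open>q\<close> and \<open>\<rho>\<close> is evaluation at
  a root of \<open>q\<close>; the ideal generated by the initial form of \<open>q\<close> is then the kernel of the map of
  graded algebras induced by \<open>v \<le> \<rho>\<close>.
\<close>

context
  fixes \<rho> :: "'r \<Rightarrow> 'h top" and q :: 'r
  assumes \<rho>: "valuation \<rho>" and le_\<rho>: "\<And>x. v x \<le> \<rho> x"
    and q: "v q \<noteq> Top" "\<rho> q = Top"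
    and approx: "\<And>x \<alpha>. Value \<alpha> \<le> v x \<Longrightarrow> Value \<alpha> < \<rho> x \<Longrightarrow> \<exists>y. Value \<alpha> \<le> v (q * y) \<and> Value \<alpha> < v (x - q * y)"
begin

interpretation \<rho>: valued_ring \<rho>
  by unfold_locales (rule \<rho>)

lemma repsD': "p \<in> reps \<Longrightarrow> Value \<alpha> \<le> \<rho> (lookup p \<alpha>)"
  using repsD le_\<rho> order_trans by blast

text \<open>Multiples of \<open>q\<close> have infinite value under \<rho>, and \<rho> is at least
  \<open>v\<close>, which gives one direction. Conversely, \<open>approx\<close> divides each
  homogeneous component by \<open>q\<close> up to terms of larger value.\<close>

lemma cls_in_PIdl_iff:
  assumes "p \<in> reps"
  shows "cls p \<in> PIdl\<^bsub>gr\<^esub> (initial_form v q) \<longleftrightarrow> (\<forall>\<alpha>. Value \<alpha> < \<rho> (lookup p \<alpha>))"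
proof
  obtain \<gamma> where \<gamma>: "v q = Value \<gamma>"
    using q by (cases "v q") auto
  have sq: "Poly_Mapping.single \<gamma> q \<in> reps"
    by (rule reps_single) (simp add: \<gamma>)
  {
    assume "cls p \<in> PIdl\<^bsub>gr\<^esub> (initial_form v q)"
    then obtain r where r: "r \<in> reps" "cls p = cls (Poly_Mapping.single \<gamma> q * r)"
      using sq by (auto simp: cgenideal_def carrier_gr initial_form_eq_cls[OF \<gamma>] cls_mult mult.commute)
    show "\<forall>\<alpha>. Value \<alpha> < \<rho> (lookup p \<alpha>)"
    proof
      fix \<alpha>
      have "Value \<alpha> < \<rho> (lookup p \<alpha> - q * lookup r (\<alpha> - \<gamma>))"
        using r(2) le_\<rho> by (metis cls_eq_iff lookup_single_times less_le_trans)
      moreover have "Value \<alpha> < \<rho> (q * lookup r (\<alpha> - \<gamma>))"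
        by (simp add: \<rho>.v_mult q)
      ultimately show "Value \<alpha> < \<rho> (lookup p \<alpha>)"
        using \<rho>.v_add_gt by fastforce
    qed
  next
    assume *: "\<forall>\<alpha>. Value \<alpha> < \<rho> (lookup p \<alpha>)"
    then have "\<exists>y. Value \<alpha> \<le> v (q * y) \<and> Value \<alpha> < v (lookup p \<alpha> - q * y)" for \<alpha>
      using approx repsD[OF assms] by blast
    then obtain y where y: "\<And>\<alpha>. Value \<alpha> \<le> v (q * y \<alpha>)" "\<And>\<alpha>. Value \<alpha> < v (lookup p \<alpha> - q * y \<alpha>)"
      by metis
    \<comment> \<open>The quotients are shifted by the degree \<gamma> of \<open>q\<close>, and set
      to 0 off the support of \<open>p\<close> to keep the support finite.\<close>
    define r where "r = Abs_poly_mapping (\<lambda>\<beta>. if \<beta> + \<gamma> \<in> keys p then y (\<beta> + \<gamma>) else 0)"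
    have "finite {\<beta>. (if \<beta> + \<gamma> \<in> keys p then y (\<beta> + \<gamma>) else 0) \<noteq> 0}"
      by (rule finite_subset[of _ "(\<lambda>\<alpha>. \<alpha> - \<gamma>) ` keys p"])
        (auto split: if_splits simp: image_iff intro!: bexI[of _ "_ + \<gamma>"])
    then have r: "lookup r \<beta> = (if \<beta> + \<gamma> \<in> keys p then y (\<beta> + \<gamma>) else 0)" for \<beta>
      unfolding r_def by (subst lookup_Abs_poly_mapping) simp_all
    have "Value \<beta> \<le> v (y (\<beta> + \<gamma>))" for \<beta>
      using y(1)[of "\<beta> + \<gamma>"] unfolding v_mult \<gamma> by (cases "v (y (\<beta> + \<gamma>))") (auto simp: add.commute)
    then have "r \<in> reps"
      by (simp add: reps_def r)
    have "cls p = cls (Poly_Mapping.single \<gamma> q * r)"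
      unfolding cls_eq_iff lookup_single_times r using y(2) by (auto simp: in_keys_iff)
    then have "cls p = cls r \<otimes>\<^bsub>gr\<^esub> initial_form v q"
      using sq \<open>r \<in> reps\<close> by (simp add: initial_form_eq_cls[OF \<gamma>] cls_mult mult.commute)
    then show "cls p \<in> PIdl\<^bsub>gr\<^esub> (initial_form v q)"
      using \<open>r \<in> reps\<close> by (auto simp: cgenideal_def carrier_gr)
  }
qed

lemma initial_form_in_PIdl_iff:
  assumes "v x \<noteq> Top"
  shows "initial_form v x \<in> PIdl\<^bsub>gr\<^esub> (initial_form v q) \<longleftrightarrow> v x < \<rho> x"
proof -
  obtain \<alpha> where \<alpha>: "v x = Value \<alpha>"
    using assms by (cases "v x") auto
  show ?thesis
    using cls_in_PIdl_iff[OF reps_single[of \<alpha> x]]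
    by (auto simp: \<alpha> initial_form_eq_cls[OF \<alpha>] lookup_single when_def)
qed

text \<open>By the membership criterion, a factor outside the ideal has a least degree in which its
  component has \<rho>-value exactly that degree. If both factors are outside, then in the sum of
  these degrees the product has one term of minimal value, which cannot cancel.\<close>

lemma primeideal_initial_form: "primeideal (PIdl\<^bsub>gr\<^esub> (initial_form v q)) gr"
proof (rule primeidealI)
  let ?I = "PIdl\<^bsub>gr\<^esub> (initial_form v q)"
  show "ideal ?I gr"
    by (rule cring.cgenideal_ideal[OF cring_gr initial_form_in_carrier[OF q(1)]])
  show "cring gr"
    by (rule cring_gr)
  have "\<one>\<^bsub>gr\<^esub> \<notin> ?I"
    using cls_in_PIdl_iff[OF reps_one] by (auto simp: cls_one lookup_one zero_top_def dest: spec[of _ 0])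
  moreover have "\<one>\<^bsub>gr\<^esub> \<in> carrier gr"
    by (simp add: carrier_gr cls_one reps_one)
  ultimately show "carrier gr \<noteq> ?I"
    by auto
  fix a b assume ab: "a \<in> carrier gr" "b \<in> carrier gr" "a \<otimes>\<^bsub>gr\<^esub> b \<in> ?I"
  then obtain p p' where p: "p \<in> reps" "p' \<in> reps" "a = cls p" "b = cls p'"
    by (auto simp: carrier_gr)
  show "a \<in> ?I \<or> b \<in> ?I"
  proof (rule ccontr)
    assume "\<not> (a \<in> ?I \<or> b \<in> ?I)"
    then have ex: "\<exists>\<alpha>. \<not> Value \<alpha> < \<rho> (lookup p \<alpha>)" "\<exists>\<alpha>. \<not> Value \<alpha> < \<rho> (lookup p' \<alpha>)"
      using cls_in_PIdl_iff p by auto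
    have least: "\<exists>\<alpha>. \<rho> (lookup s \<alpha>) = Value \<alpha> \<and> (\<forall>\<beta><\<alpha>. Value \<beta> < \<rho> (lookup s \<beta>))"
      if s: "s \<in> reps" "\<exists>\<alpha>. \<not> Value \<alpha> < \<rho> (lookup s \<alpha>)" for s
    proof -
      define N where "N = {\<alpha>. \<not> Value \<alpha> < \<rho> (lookup s \<alpha>)}"
      have "N \<subseteq> keys s"
        by (auto simp: N_def in_keys_iff)
      then have fin: "finite N"
        by (rule finite_subset) simp
      have "Min N \<in> N"
        using fin s(2) by (intro Min_in) (auto simp: N_def)
      then have "\<rho> (lookup s (Min N)) = Value (Min N)"
        using repsD'[OF s(1), of "Min N"] by (simp add: N_def)
      moreover have "Value \<beta> < \<rho> (lookup s \<beta>)" if "\<beta> < Min N" for \<beta>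
        using Min_le[OF fin, of \<beta>] that unfolding N_def by fastforce
      ultimately show ?thesis
        by blast
    qed
    obtain \<alpha> where \<alpha>: "\<rho> (lookup p \<alpha>) = Value \<alpha>" "\<And>\<beta>. \<beta> < \<alpha> \<Longrightarrow> Value \<beta> < \<rho> (lookup p \<beta>)"
      using least[OF p(1) ex(1)] by blast
    obtain \<alpha>' where \<alpha>': "\<rho> (lookup p' \<alpha>') = Value \<alpha>'" "\<And>\<beta>. \<beta> < \<alpha>' \<Longrightarrow> Value \<beta> < \<rho> (lookup p' \<beta>)"
      using least[OF p(2) ex(2)] by blast
    define \<gamma> where "\<gamma> = \<alpha> + \<alpha>'"
    let ?r = "\<Sum>\<beta>\<in>keys p - {\<alpha>}. lookup p \<beta> * lookup p' (\<gamma> - \<beta>)"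
    have "\<alpha> \<in> keys p"
      using \<alpha>(1) by (auto simp: in_keys_iff)
    then have eq: "lookup (p * p') \<gamma> = lookup p \<alpha> * lookup p' \<alpha>' + ?r"
      unfolding lookup_times by (subst sum.remove[of _ \<alpha>]) (auto simp: \<gamma>_def)
    have "Value \<gamma> < \<rho> ?r"
    proof (rule \<rho>.v_sum_gt)
      fix \<beta> assume "\<beta> \<in> keys p - {\<alpha>}"
      then have "\<beta> < \<alpha> \<or> \<gamma> - \<beta> < \<alpha>'"
        by (auto simp: \<gamma>_def algebra_simps)
      then show "Value \<gamma> < \<rho> (lookup p \<beta> * lookup p' (\<gamma> - \<beta>))"
        using \<rho>.Value_less_times[OF \<alpha>(2) repsD'[OF p(2)]] \<rho>.Value_less_times'[OF repsD'[OF p(1)] \<alpha>'(2)]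
        by blast
    qed simp
    then have "\<rho> (lookup (p * p') \<gamma>) = Value \<gamma>"
      unfolding eq by (subst \<rho>.v_add_eq) (auto simp: \<rho>.v_mult \<alpha> \<alpha>' \<gamma>_def)
    moreover have "Value \<gamma> < \<rho> (lookup (p * p') \<gamma>)"
      using ab(3) cls_in_PIdl_iff[OF reps_times] p by (simp add: cls_mult)
    ultimately show False
      by simp
  qed
qed

end

end

subsection \<open>Truncations at polynomials without close competitors\<close>

text \<open>Isolates what a frame supplies about a member \<open>Q\<close> of degree below that of
  \<open>F\<close>: \<alpha> is a root of \<open>Q\<close> nearest to \<theta>, and
  \<open>small\<close> keeps the roots of polynomials of smaller degree strictly farther
  away.\<close>

locale key_center = henselian_field v
  for v :: "'a::field \<Rightarrow> 'g::linordered_ab_group_add top" +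
  fixes \<theta> :: "'a alg_closure" and Q :: "'a poly" and \<alpha> :: "'a alg_closure" and \<delta> :: "'g div_hull"
  assumes Q_monic: "monic Q" and Q_irreducible: "irreducible Q"
    and \<alpha>_root: "\<alpha> \<in># roots Q"
    and dist_\<alpha>: "w (\<theta> - \<alpha>) = Value \<delta>"
    and nearest: "\<And>\<beta>. \<beta> \<in># roots Q \<Longrightarrow> w (\<theta> - \<beta>) \<le> Value \<delta>"
    and small: "\<And>a \<beta>. a \<noteq> 0 \<Longrightarrow> degree a < degree Q \<Longrightarrow> \<beta> \<in># roots a \<Longrightarrow> w (\<theta> - \<beta>) < Value \<delta>"
begin

abbreviation "\<nu> \<equiv> root_valuation v \<theta>"
abbreviation "\<rho> \<equiv> root_valuation v \<alpha>"
abbreviation "gc \<equiv> gauss_at w \<alpha> \<delta>"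

sublocale gc: valued_ring gc
  by unfold_locales (rule w.valuation_gauss_at)

definition \<mu> :: "'a poly \<Rightarrow> 'g div_hull top" where
  "\<mu> f = gc (map_poly to_ac f)"

lemma valuation_root_valuation: "valuation (root_valuation v x)"
proof -
  have "ring_hom_fun (\<lambda>f. poly (map_poly to_ac f) x)"
    by unfold_locales (simp_all add: ac_poly.hom_add ac_poly.hom_mult ac_poly.hom_1)
  then show ?thesis
    unfolding root_valuation_def by (rule valuation_comp_hom[OF w.val])
qed

sublocale \<mu>: valued_ring \<mu>
  unfolding \<mu>_def by unfold_locales (rule valuation_comp_hom[OF gc.val ac_poly.ring_hom_fun_axioms])

sublocale \<nu>: valued_ring \<nu>
  by unfold_locales (rule valuation_root_valuation)

sublocale \<rho>: valued_ring \<rho>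
  by unfold_locales (rule valuation_root_valuation)

lemma Q_nonzero: "Q \<noteq> 0"
  using Q_monic by (rule monic_nonzero)

lemma Q_\<alpha>: "poly (map_poly to_ac Q) \<alpha> = 0"
  using \<alpha>_root Q_nonzero by (simp add: set_roots)

lemma \<rho>_add_Q_mult: "\<rho> (a + Q * f) = \<rho> a"
  by (simp add: root_valuation_def ac_poly.hom_add ac_poly.hom_mult Q_\<alpha>)

lemma \<rho>_Q: "\<rho> Q = Top"
  by (simp add: root_valuation_def Q_\<alpha>)

lemma degree_Q: "0 < degree Q"
  using \<alpha>_root map_poly_to_ac_factor(2)[OF Q_nonzero] by (cases "roots Q") auto

lemma \<mu>_le_\<rho>: "\<mu> f \<le> \<rho> f"
  unfolding \<mu>_def root_valuation_def by (rule w.gauss_at_le_v_poly_centre)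

text \<open>A point \<beta> farther from \<theta> than \<alpha> is as far from \<alpha> as from
  \<theta>; one at the same distance has \<open>w (\<alpha> - \<beta>)\<close> at least
  \<open>Value \<delta>\<close>. Either way the minimum in \<open>gauss_at_linear\<close> is
  \<open>w (\<theta> - \<beta>)\<close>.\<close>

lemma gc_linear:
  assumes "w (\<theta> - \<beta>) \<le> Value \<delta>"
  shows "gc [:- \<beta>, 1:] = w (\<theta> - \<beta>)"
proof (cases "w (\<theta> - \<beta>) = Value \<delta>")
  case True
  then have "Value \<delta> \<le> w (\<alpha> - \<beta>)"
    using w.v_diff_ge[of "Value \<delta>" "\<theta> - \<beta>" "\<theta> - \<alpha>"] dist_\<alpha> by simp
  then show ?thesis
    using True by (simp add: w.gauss_at_linear min_def)
next
  case False
  then have "w (\<theta> - \<beta>) < Value \<delta>"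
    using assms by simp
  moreover from this have "w (\<alpha> - \<beta>) = w (\<theta> - \<beta>)"
    using w.v_diff_eq[of "\<theta> - \<beta>" "\<theta> - \<alpha>"] dist_\<alpha> by simp
  ultimately show ?thesis
    by (simp add: w.gauss_at_linear min.absorb1)
qed

text \<open>Both sides are multiplicative, so it suffices to compare the linear factors over the
  closure, which is \<open>gc_linear\<close>.\<close>

lemma \<mu>_eq_\<nu>:
  assumes "f \<noteq> 0" "\<And>\<beta>. \<beta> \<in># roots f \<Longrightarrow> w (\<theta> - \<beta>) \<le> Value \<delta>"
  shows "\<mu> f = \<nu> f"
proof -
  have "\<mu> f = gc ([:to_ac (lead_coeff f):] * (\<Prod>a\<in>#roots f. [:-a, 1:]))"
    unfolding \<mu>_def by (subst map_poly_to_ac_factor(1)[OF assms(1)]) simp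
  also have "\<dots> = w (to_ac (lead_coeff f)) + (\<Sum>a\<in>#roots f. gc [:-a, 1:])"
    by (simp only: gc.v_mult gc.v_prod_mset w.gauss_at_const image_mset.compositionality o_def)
  also have "(\<Sum>a\<in>#roots f. gc [:-a, 1:]) = (\<Sum>a\<in>#roots f. w (\<theta> - a))"
    by (rule arg_cong[where f = sum_mset], rule image_mset_cong) (rule gc_linear[OF assms(2)])
  finally show ?thesis
    using root_valuation_eq_sum[OF assms(1)] by simp
qed

text \<open>The constant Taylor term at \<alpha> strictly dominates the others. Such polynomials
  behave like nonzero constants under the Gauss valuation.\<close>

definition near_constant :: "'a alg_closure poly \<Rightarrow> bool" where
  "near_constant p \<longleftrightarrow> gc p < gc (p - [:poly p \<alpha>:])"

lemma near_constant_eq: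
  assumes "near_constant p"
  shows "gc p = w (poly p \<alpha>)"
  using gc.v_eqI[of p "[:poly p \<alpha>:]"] assms by (simp add: near_constant_def)

text \<open>The error \<open>p q - p(\<alpha>) q(\<alpha>)\<close> splits into two products, each
  containing the error of one factor.\<close>

lemma near_constant_mult:
  assumes p: "near_constant p" and q: "near_constant q"
  shows "near_constant (p * q)"
proof -
  have not_Top: "gc p \<noteq> Top" "gc q \<noteq> Top"
    using p q unfolding near_constant_def by (metis less_top_Top)+
  have "gc (p * q) < gc ((p - [:poly p \<alpha>:]) * q)"
    using p not_Top unfolding near_constant_def gc.v_mult by (intro top_add_strict_mono1)
  moreover have "gc (p * q) < gc ([:poly p \<alpha>:] * (q - [:poly q \<alpha>:]))"
    using q not_Top near_constant_eq[OF p] unfolding near_constant_def gc.v_mult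
    by (intro top_add_le_less_mono) auto
  ultimately have "gc (p * q) < gc ((p - [:poly p \<alpha>:]) * q + [:poly p \<alpha>:] * (q - [:poly q \<alpha>:]))"
    by (rule gc.v_add_gt)
  also have "(p - [:poly p \<alpha>:]) * q + [:poly p \<alpha>:] * (q - [:poly q \<alpha>:]) = p * q - [:poly (p * q) \<alpha>:]"
    by (simp add: left_diff_distrib smult_diff_right)
  finally show ?thesis
    by (simp add: near_constant_def)
qed

text \<open>By \<open>small\<close>, each root \<open>b\<close> of \<open>a\<close> has
  \<open>w (\<theta> - b) < Value \<delta>\<close>, so in
  \<open>X - b = (X - \<alpha>) + (\<alpha> - b)\<close> the constant dominates; products preserve
  this.\<close>

lemma near_constant_small:
  assumes "a \<noteq> 0" "degree a < degree Q"
  shows "near_constant (map_poly to_ac a)"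
proof -
  have const: "near_constant [:c:]" if "c \<noteq> 0" for c
    using that by (simp add: near_constant_def flip: not_Top_iff_less)
  have "near_constant (\<Prod>b\<in>#A. [:-b, 1:])" if "set_mset A \<subseteq> set_mset (roots a)" for A
    using that
  proof (induction A)
    case empty
    show ?case
      using const[of 1] by (simp add: one_pCons)
  next
    case (add b A)
    have b: "w (\<theta> - b) < Value \<delta>"
      using small[OF assms] add by auto
    have "gc [:-b, 1:] = w (\<theta> - b)"
      using b by (intro gc_linear) simp
    moreover have "gc [:-\<alpha>, 1:] = Value \<delta>"
      by (simp add: w.gauss_at_linear)
    ultimately have "near_constant [:-b, 1:]"
      using b by (simp add: near_constant_def)
    then show ?case
      using add near_constant_mult[of "[:-b, 1:]"] by (simp del: mult_pCons_left)
  qed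
  then have "near_constant ([:to_ac (lead_coeff a):] * (\<Prod>b\<in>#roots a. [:-b, 1:]))"
    using assms(1) by (intro near_constant_mult const) auto
  then show ?thesis
    by (subst map_poly_to_ac_factor(1)[OF assms(1)]) simp
qed

lemma \<mu>_eq_\<rho>: "degree a < degree Q \<Longrightarrow> \<mu> a = \<rho> a"
  using near_constant_eq[OF near_constant_small[of a]]
  by (cases "a = 0") (auto simp: \<mu>_def root_valuation_def)

lemma \<mu>_eq_\<nu>_small: "degree a < degree Q \<Longrightarrow> \<mu> a = \<nu> a"
  using \<mu>_eq_\<nu>[of a] small[of a] by (cases "a = 0") (auto intro: less_imp_le)

lemma \<mu>_eq_\<nu>_Q: "\<mu> Q = \<nu> Q"
  using Q_nonzero nearest by (rule \<mu>_eq_\<nu>)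

lemma \<mu>_Q_not_Top: "\<mu> Q \<noteq> Top"
proof
  assume "\<mu> Q = Top"
  then have "poly (map_poly to_ac Q) \<theta> = 0"
    by (simp add: \<mu>_eq_\<nu>_Q root_valuation_def)
  then have "\<theta> \<in># roots Q"
    by (simp add: set_roots Q_nonzero)
  then show False
    using nearest[of \<theta>] by simp
qed

text \<open>
  Evaluating at \<open>\<alpha>\<close> kills all terms of a \<open>Q\<close>-expansion but the first, on which \<open>\<mu>\<close> agrees with
  evaluation at \<open>\<alpha>\<close>; so no term can cancel against the others.
\<close>

lemma \<mu>_add_Q_mult_le:
  assumes "degree a < degree Q"
  shows "\<mu> (a + Q * f) \<le> \<mu> a"
  using \<mu>_le_\<rho>[of "a + Q * f"] \<mu>_eq_\<rho>[OF assms] by (simp add: \<rho>_add_Q_mult)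

text \<open>Induction over the digits, where \<open>k\<close> counts the factors \<open>Q\<close>
  already split off. The lowest digit has at least the value of the whole by
  \<open>\<mu>_add_Q_mult_le\<close>, hence so does the rest.\<close>

lemma le_\<mu>_expansion:
  assumes "\<And>s. degree (coeff a s) < degree Q"
  shows "c \<le> \<mu> (Q ^ k * poly a Q) \<longleftrightarrow> (\<forall>s. c \<le> \<mu> (coeff a s * Q ^ (k + s)))"
  using assms
proof (induction a arbitrary: k)
  case 0
  then show ?case by simp
next
  case (pCons a b)
  have a: "degree a < degree Q" and b: "\<And>s. degree (coeff b s) < degree Q"
    using pCons(3) by (metis coeff_pCons_0, metis coeff_pCons_Suc)
  have "c \<le> \<mu> (Q ^ k * poly (pCons a b) Q) \<longleftrightarrow> c \<le> \<mu> (Q ^ k * a) \<and> c \<le> \<mu> (Q ^ Suc k * poly b Q)"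
  proof
    assume *: "c \<le> \<mu> (Q ^ k * poly (pCons a b) Q)"
    also have "\<dots> \<le> \<mu> (Q ^ k * a)"
      using \<mu>_add_Q_mult_le[OF a] by (simp add: \<mu>.v_mult add_left_mono)
    finally have "c \<le> \<mu> (Q ^ k * a)" .
    moreover have "Q ^ Suc k * poly b Q = Q ^ k * poly (pCons a b) Q - Q ^ k * a"
      by (simp add: algebra_simps)
    ultimately show "c \<le> \<mu> (Q ^ k * a) \<and> c \<le> \<mu> (Q ^ Suc k * poly b Q)"
      using * \<mu>.v_diff_ge by metis
  next
    assume "c \<le> \<mu> (Q ^ k * a) \<and> c \<le> \<mu> (Q ^ Suc k * poly b Q)"
    then show "c \<le> \<mu> (Q ^ k * poly (pCons a b) Q)"
      using \<mu>.v_add_ge[of c "Q ^ k * a" "Q ^ Suc k * poly b Q"] by (simp add: algebra_simps)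
  qed
  also have "\<dots> \<longleftrightarrow> (\<forall>s. c \<le> \<mu> (coeff (pCons a b) s * Q ^ (k + s)))"
  proof -
    have all_nat: "(\<forall>s. P s) \<longleftrightarrow> P 0 \<and> (\<forall>s. P (Suc s))" for P :: "nat \<Rightarrow> bool"
      by (metis not0_implies_Suc)
    show ?thesis
      using pCons(2)[OF b, of "Suc k"]
      by (subst all_nat) (simp add: mult.commute)
  qed
  finally show ?case .
qed

text \<open>\<mu> and \<nu> agree on \<open>Q\<close> and on all digits, so the terms of the
  truncation may be valued by \<mu>; by \<open>le_\<mu>_expansion\<close> their minimum has the same
  lower bounds as \<open>\<mu> f\<close>.\<close>

lemma truncation_eq_\<mu>: "truncation \<nu> Q = \<mu>"
proof
  fix f
  have term_eq: "\<nu> (coeff (expansion Q f) s * Q ^ s) = \<mu> (coeff (expansion Q f) s * Q ^ s)" for s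
  proof -
    have "\<nu> (Q ^ s) = \<mu> (Q ^ s)"
      by (induction s) (simp_all add: \<nu>.v_mult \<mu>.v_mult \<mu>_eq_\<nu>_Q)
    then show ?thesis
      using \<mu>_eq_\<nu>_small[OF degree_coeff_expansion[OF degree_Q]] by (simp add: \<nu>.v_mult \<mu>.v_mult)
  qed
  have "c \<le> truncation \<nu> Q f \<longleftrightarrow> c \<le> \<mu> f" for c
    using le_\<mu>_expansion[of "expansion Q f" c 0] degree_coeff_expansion[OF degree_Q]
    by (simp add: le_truncation_iff term_eq poly_expansion[OF degree_Q])
  then show "truncation \<nu> Q f = \<mu> f"
    by (metis order_antisym order_refl)
qed

section \<open>The key polynomial property of \<open>Q\<close>\<close>

lemma approx:
  assumes "Value \<beta> \<le> \<mu> f" "Value \<beta> < \<rho> f"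
  shows "\<exists>g. Value \<beta> \<le> \<mu> (Q * g) \<and> Value \<beta> < \<mu> (f - Q * g)"
proof (intro exI conjI)
  \<comment> \<open>The witness is \<open>f div Q\<close>: the remainder has the same value under
    \<rho> as \<open>f\<close>, and below the degree of \<open>Q\<close> the valuations \<mu> and
    \<rho> coincide.\<close>
  have eq: "f - Q * (f div Q) = f mod Q"
    by (simp add: minus_mult_div_eq_mod)
  have "degree (f mod Q) < degree Q"
    using degree_mod_less[OF Q_nonzero, of f] degree_Q by auto
  moreover have "\<rho> (f mod Q) = \<rho> f"
    using \<rho>_add_Q_mult[of "f mod Q" "f div Q"] by simp
  ultimately show less: "Value \<beta> < \<mu> (f - Q * (f div Q))"
    using assms(2) by (simp add: eq \<mu>_eq_\<rho>)
  show "Value \<beta> \<le> \<mu> (Q * (f div Q))"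
    using \<mu>.v_diff_ge[OF assms(1) less_imp_le[OF less]] by simp
qed

lemmas in_PIdl_iff = \<mu>.initial_form_in_PIdl_iff[OF \<rho>.val \<mu>_le_\<rho> \<mu>_Q_not_Top \<rho>_Q approx]

lemma \<mu>_not_Top: "a \<noteq> 0 \<Longrightarrow> degree a < degree Q \<Longrightarrow> \<mu> a \<noteq> Top"
  using near_constant_small[of a] unfolding near_constant_def \<mu>_def by (metis less_top_Top)

text \<open>Primality comes from the kernel description of the ideal. A nonzero \<open>f\<close> of
  degree below that of \<open>Q\<close> has \<open>\<mu> f = \<rho> f\<close>, so its initial form
  is outside the ideal.\<close>

lemma key_polynomial_Q: "key_polynomial \<mu> Q"
  unfolding key_polynomial_def
proof (intro conjI allI impI)
  let ?I = "PIdl\<^bsub>graded_algebra \<mu>\<^esub> (initial_form \<mu> Q)"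
  show "monic Q"
    by (rule Q_monic)
  show "primeideal ?I (graded_algebra \<mu>)"
    by (rule \<mu>.primeideal_initial_form[OF \<rho>.val \<mu>_le_\<rho> \<mu>_Q_not_Top \<rho>_Q approx])
  obtain \<gamma> where \<gamma>: "\<mu> Q = Value \<gamma>"
    using \<mu>_Q_not_Top by (cases "\<mu> Q") auto
  have "initial_form \<mu> Q \<noteq> \<zero>\<^bsub>graded_algebra \<mu>\<^esub>"
    unfolding \<mu>.initial_form_eq_cls[OF \<gamma>] \<mu>.cls_zero \<mu>.cls_eq_iff
    by (auto simp: lookup_single \<gamma> intro!: exI[of _ \<gamma>])
  moreover have "initial_form \<mu> Q \<in> ?I"
    using \<gamma> \<rho>_Q by (simp add: in_PIdl_iff)
  ultimately show "?I \<noteq> {\<zero>\<^bsub>graded_algebra \<mu>\<^esub>}"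
    by blast
  fix f :: "'a poly" assume f: "f \<noteq> 0 \<and> degree f < degree Q"
  show "\<not> graded_dvd \<mu> Q f"
  proof
    assume "graded_dvd \<mu> Q f"
    then obtain c where c: "c \<in> carrier (graded_algebra \<mu>)"
      "initial_form \<mu> f = initial_form \<mu> Q \<otimes>\<^bsub>graded_algebra \<mu>\<^esub> c"
      by (auto simp: graded_dvd_def factor_def)
    then have "initial_form \<mu> f = c \<otimes>\<^bsub>graded_algebra \<mu>\<^esub> initial_form \<mu> Q"
      using comm_monoid.m_comm[OF cring.axioms(2)[OF \<mu>.cring_gr]] \<mu>.initial_form_in_carrier[OF \<mu>_Q_not_Top]
      by metis
    then have "initial_form \<mu> f \<in> ?I"
      using c(1) by (auto simp: cgenideal_def)
    then show False
      using f \<mu>_not_Top[of f] \<mu>_eq_\<rho>[of f] by (simp add: in_PIdl_iff)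
  qed
qed

text \<open>Inverting \<open>a\<close> modulo \<open>Q\<close> by a Bezout identity gives
  \<open>b\<close> of small degree with \<open>a * b\<close> equal to 1 at \<alpha>. Both factors
  are near constant, hence so is the product, and it differs from 1 by positive value.\<close>

lemma initial_form_small_unit:
  assumes "a \<noteq> 0" "degree a < degree Q"
  shows "\<exists>b. \<mu> b \<noteq> Top \<and> initial_form \<mu> a \<otimes>\<^bsub>graded_algebra \<mu>\<^esub> initial_form \<mu> b = \<one>\<^bsub>graded_algebra \<mu>\<^esub>"
proof -
  have "\<not> Q dvd a"
    using assms dvd_imp_degree_le by (metis not_le)
  then obtain s t where st: "s * Q + t * a = 1"
    using bezout_irreducible Q_irreducible by blast
  define b where "b = t mod Q"
  have b: "degree b < degree Q"
    unfolding b_def using degree_mod_less[OF Q_nonzero, of t] degree_Q by auto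
  have "a * b = 1 + Q * (- s - t div Q * a)"
  proof -
    have "b = t - t div Q * Q"
      by (simp add: b_def minus_div_mult_eq_mod)
    then have "a * b = t * a - Q * (t div Q * a)"
      by (simp only: right_diff_distrib mult_ac)
    also have "t * a = 1 - s * Q"
      using st by (simp add: algebra_simps)
    finally show ?thesis
      by (simp add: algebra_simps)
  qed
  then have val1: "poly (map_poly to_ac (a * b)) \<alpha> = 1"
    by (simp add: Q_\<alpha> ac_poly.hom_add ac_poly.hom_mult ac_poly.hom_1)
  then have "b \<noteq> 0"
    by auto
  then have near: "near_constant (map_poly to_ac (a * b))"
    using assms b near_constant_small near_constant_mult by (simp add: ac_poly.hom_mult)
  then have "\<mu> (a * b) < \<mu> (a * b - 1)"
    by (simp add: near_constant_def \<mu>_def val1 ac_poly.hom_diff ac_poly.hom_1 flip: one_pCons)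
  moreover have "\<mu> (a * b) = 0"
    using near_constant_eq[OF near] by (simp add: \<mu>_def val1)
  ultimately have "initial_form \<mu> a \<otimes>\<^bsub>graded_algebra \<mu>\<^esub> initial_form \<mu> b = \<one>\<^bsub>graded_algebra \<mu>\<^esub>"
    by (intro \<mu>.initial_form_unit) (simp_all add: \<mu>.v_mult)
  then show ?thesis
    using \<mu>_not_Top[OF \<open>b \<noteq> 0\<close> b] by blast
qed

text \<open>Below that degree initial forms are units and generate the whole ring, which is not a
  prime ideal.\<close>

lemma degree_Q_le_key_polynomial:
  assumes "key_polynomial \<mu> \<phi>"
  shows "degree Q \<le> degree \<phi>"
proof (rule ccontr)
  let ?I = "PIdl\<^bsub>graded_algebra \<mu>\<^esub> (initial_form \<mu> \<phi>)"
  assume "\<not> degree Q \<le> degree \<phi>"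
  moreover have "\<phi> \<noteq> 0"
    using assms monic_nonzero by (auto simp: key_polynomial_def)
  ultimately obtain b where b: "\<mu> b \<noteq> Top"
    "initial_form \<mu> \<phi> \<otimes>\<^bsub>graded_algebra \<mu>\<^esub> initial_form \<mu> b = \<one>\<^bsub>graded_algebra \<mu>\<^esub>"
    using initial_form_small_unit[of \<phi>] by auto
  have prime: "primeideal ?I (graded_algebra \<mu>)"
    using assms by (simp add: key_polynomial_def)
  then have ideal: "ideal ?I (graded_algebra \<mu>)"
    by (rule primeideal.axioms(1))
  have "initial_form \<mu> \<phi> \<in> carrier (graded_algebra \<mu>)"
    using \<mu>_not_Top[OF \<open>\<phi> \<noteq> 0\<close>] \<open>\<not> degree Q \<le> degree \<phi>\<close> by (intro \<mu>.initial_form_in_carrier) simp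
  then have "\<one>\<^bsub>graded_algebra \<mu>\<^esub> \<in> ?I"
    using b(2) ideal.I_r_closed[OF ideal ring.cgenideal_self[OF cring.axioms(1)[OF \<mu>.cring_gr]]] \<mu>.initial_form_in_carrier[OF b(1)]
    by metis
  then have "?I = carrier (graded_algebra \<mu>)"
    using ideal.one_imp_carrier[OF ideal] by blast
  then show False
    using primeideal.I_notcarr[OF prime] by simp
qed

lemma abstract_key_polynomial_Q: "abstract_key_polynomial \<nu> Q"
  using Q_monic degree_Q \<mu>.val key_polynomial_Q degree_Q_le_key_polynomial
  by (simp add: abstract_key_polynomial_def truncation_eq_\<mu>)

end

subsection \<open>Okutsu frames\<close>

text \<open>A polynomial of least degree with root \<beta> is irreducible and divides every
  polynomial with that root; scaling makes it monic.\<close>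

lemma minimal_polynomial_factor:
  fixes f :: "'a::field poly"
  assumes "f \<noteq> 0" "\<beta> \<in># roots f"
  obtains h where "monic h" "irreducible h" "h dvd f" "\<beta> \<in># roots h"
proof -
  let ?P = "\<lambda>h::'a poly. h \<noteq> 0 \<and> poly (map_poly to_ac h) \<beta> = 0"
  have "?P f"
    using assms by (simp add: set_roots)
  then obtain h where h: "?P h" and min: "\<And>g. ?P g \<Longrightarrow> degree h \<le> degree g"
    using ex_has_least_nat[of ?P f degree] by blast
  have irr: "irreducible h"
  proof (rule irreducibleI)
    show "h \<noteq> 0"
      using h by simp
    show "\<not> is_unit h"
    proof
      assume "is_unit h"
      then obtain g where "1 = h * g" by blast
      then have "poly (map_poly to_ac (h * g)) \<beta> = 1"
        by (metis ac_poly.hom_1 poly_1)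
      then show False
        using h by (simp add: ac_poly.hom_mult)
    qed
    fix a b assume ab: "h = a * b"
    then have "poly (map_poly to_ac a) \<beta> = 0 \<or> poly (map_poly to_ac b) \<beta> = 0"
      using h by (simp add: ac_poly.hom_mult)
    moreover have "a \<noteq> 0" "b \<noteq> 0"
      using h ab by auto
    ultimately have "degree h \<le> degree a \<or> degree h \<le> degree b"
      using min by blast
    moreover have "degree h = degree a + degree b"
      using ab \<open>a \<noteq> 0\<close> \<open>b \<noteq> 0\<close> by (simp add: degree_mult_eq)
    ultimately have "degree a = 0 \<or> degree b = 0"
      by auto
    then show "is_unit a \<or> is_unit b"
      using \<open>a \<noteq> 0\<close> \<open>b \<noteq> 0\<close> by (simp add: is_unit_iff_degree)
  qed
  define g where "g = smult (inverse (lead_coeff h)) h"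
  have lc: "lead_coeff h \<noteq> 0"
    using h by simp
  have g: "monic g" "\<beta> \<in># roots g"
    using h by (auto simp: g_def monic_def set_roots map_poly_smult)
  have assoc: "g dvd h" "h dvd g"
    using lc by (auto simp: g_def smult_dvd_iff dvd_smult)
  have "irreducible g"
    using irr lc irreducible_mult_unit_left[of "[:inverse (lead_coeff h):]" h]
    by (simp add: g_def is_unit_pCons_iff)
  moreover have "g dvd f"
    using irreducible_dvd_iff_root[OF irr] h \<open>?P f\<close> assoc(1) dvd_trans by blast
  ultimately show ?thesis
    using g that by blast
qed

context henselian_field
begin

text \<open>Take \<alpha> to be a root of \<open>Q\<close> nearest to \<theta>. A root of
  \<open>h\<close> that violated one of the distance bounds would, by
  \<open>wt_le_by_root_distance\<close>, make the weight of \<open>h\<close> at least that of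
  \<open>Q\<close>, or strictly larger, against the assumed weight inequality.\<close>

lemma ex_key_center:
  assumes Q: "monic Q" "irreducible Q" "poly (map_poly to_ac Q) \<theta> \<noteq> 0"
    and wt_less: "\<And>h. monic h \<Longrightarrow> 0 < degree h \<Longrightarrow> degree h < degree Q \<Longrightarrow>
      wt (root_valuation v \<theta>) h < wt (root_valuation v \<theta>) Q"
  obtains \<alpha> \<delta> where "key_center v \<theta> Q \<alpha> \<delta>"
    "\<And>h \<beta>. monic h \<Longrightarrow> irreducible h \<Longrightarrow> \<beta> \<in># roots h \<Longrightarrow>
      wt (root_valuation v \<theta>) h \<le> wt (root_valuation v \<theta>) Q \<Longrightarrow> w (\<theta> - \<beta>) \<le> Value \<delta>"
proof -
  let ?R = "(\<lambda>a. w (\<theta> - a)) ` set_mset (roots Q)"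
  have "Q \<noteq> 0"
    using Q(1) by (rule monic_nonzero)
  then have "degree Q \<noteq> 0"
    using Q(2) by (metis irreducible_def is_unit_iff_degree)
  then have "roots Q \<noteq> {#}"
    using map_poly_to_ac_factor(2)[OF \<open>Q \<noteq> 0\<close>] by auto
  then have "Max ?R \<in> ?R"
    by (intro Max_in) auto
  then obtain \<alpha> where \<alpha>: "\<alpha> \<in># roots Q" "w (\<theta> - \<alpha>) = Max ?R"
    by auto
  have nearest: "w (\<theta> - \<beta>) \<le> w (\<theta> - \<alpha>)" if "\<beta> \<in># roots Q" for \<beta>
    using that by (simp add: \<alpha>(2))
  have "\<theta> \<noteq> \<alpha>"
    using \<alpha>(1) Q(3) \<open>Q \<noteq> 0\<close> by (auto simp: set_roots)
  then obtain \<delta> where \<delta>: "w (\<theta> - \<alpha>) = Value \<delta>"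
    by (cases "w (\<theta> - \<alpha>)") auto
  have wt_Q_not_Top: "wt (root_valuation v \<theta>) Q \<noteq> Top"
    using Q(3) by (cases "root_valuation v \<theta> Q") (auto simp: wt_def root_valuation_def)
  have no_root: "poly (map_poly to_ac h) \<theta> \<noteq> 0" if "wt (root_valuation v \<theta>) h \<le> wt (root_valuation v \<theta>) Q" for h
    using that wt_Q_not_Top by (auto simp: wt_def root_valuation_def dest: less_eq_top_is_Top)
  have le: "w (\<theta> - \<beta>) \<le> Value \<delta>"
    if h: "monic h" "irreducible h" "\<beta> \<in># roots h" "wt (root_valuation v \<theta>) h \<le> wt (root_valuation v \<theta>) Q"
    for h \<beta>
  proof (rule ccontr)
    assume "\<not> w (\<theta> - \<beta>) \<le> Value \<delta>"
    then have "w (\<theta> - \<alpha>) < w (\<theta> - \<beta>)"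
      by (simp add: \<delta>)
    then show False
      using wt_le_by_root_distance(2)[OF Q \<alpha>(1) h(1,2) no_root[OF h(4)] h(3) nearest] h(4)
        by (simp add: less_imp_le)
  qed
  have "key_center v \<theta> Q \<alpha> \<delta>"
  proof
    fix a :: "'a poly" and \<beta> assume a: "a \<noteq> 0" "degree a < degree Q" "\<beta> \<in># roots a"
    then obtain h where h: "monic h" "irreducible h" "h dvd a" "\<beta> \<in># roots h"
      using minimal_polynomial_factor by blast
    have "degree h < degree Q"
      using a h(3) dvd_imp_degree_le le_less_trans by blast
    moreover have "0 < degree h"
      using h(2) monic_nonzero[OF h(1)] by (metis gr0I irreducible_def is_unit_iff_degree)
    ultimately have less: "wt (root_valuation v \<theta>) h < wt (root_valuation v \<theta>) Q"
      using wt_less h(1) by blast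
    show "w (\<theta> - \<beta>) < Value \<delta>"
    proof (rule ccontr)
      assume "\<not> w (\<theta> - \<beta>) < Value \<delta>"
      then have "w (\<theta> - \<alpha>) \<le> w (\<theta> - \<beta>)"
        by (simp add: \<delta>)
      then show False
        using wt_le_by_root_distance(1)[OF Q \<alpha>(1) h(1,2) no_root[OF less_imp_le[OF less]] h(4) nearest] less by simp
    qed
  qed (use Q \<alpha> \<delta> nearest in auto)
  then show ?thesis
    using le by (rule that)
qed

text \<open>All terms of the \<open>f\<close>-expansion but the first vanish at \<theta>, so only
  the constant digit counts on either side.\<close>

lemma truncation_eq_root_valuation:
  assumes "poly (map_poly to_ac f) \<theta> = 0" "0 < degree f"
  shows "truncation (root_valuation v \<theta>) f g = root_valuation v \<theta> g"
proof -
  obtain c b where cb: "expansion f g = pCons c b"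
    by (metis pCons_cases)
  have "g = c + f * poly b f"
    using poly_expansion[OF assms(2), of g] by (simp add: cb)
  then have val: "root_valuation v \<theta> g = root_valuation v \<theta> c"
    using assms(1) by (simp add: root_valuation_def ac_poly.hom_add ac_poly.hom_mult)
  have power: "root_valuation v \<theta> (a * f ^ Suc s) = Top" for a s
    using assms(1) by (simp add: root_valuation_def ac_poly.hom_mult)
  have "x \<le> truncation (root_valuation v \<theta>) f g \<longleftrightarrow> x \<le> root_valuation v \<theta> g" for x
  proof -
    have "x \<le> truncation (root_valuation v \<theta>) f g \<longleftrightarrow>
        (\<forall>s. x \<le> root_valuation v \<theta> (coeff (pCons c b) s * f ^ s))"
      by (subst le_truncation_iff) (simp_all add: root_valuation_def cb)
    also have "\<dots> \<longleftrightarrow> x \<le> root_valuation v \<theta> c"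
    proof
      assume "\<forall>s. x \<le> root_valuation v \<theta> (coeff (pCons c b) s * f ^ s)"
      from spec[OF this, of 0] show "x \<le> root_valuation v \<theta> c"
        by simp
    next
      assume *: "x \<le> root_valuation v \<theta> c"
      show "\<forall>s. x \<le> root_valuation v \<theta> (coeff (pCons c b) s * f ^ s)"
      proof
        fix s show "x \<le> root_valuation v \<theta> (coeff (pCons c b) s * f ^ s)"
          by (cases s) (simp_all add: * power del: power_Suc)
      qed
    qed
    finally show ?thesis
      by (simp add: val)
  qed
  then show ?thesis
    by (metis order_antisym order_refl)
qed

lemma abstract_key_polynomial_minimal:
  assumes "monic F" "irreducible F" "0 < degree F" "poly (map_poly to_ac F) \<theta> = 0"
  shows "abstract_key_polynomial (root_valuation v \<theta>) F"
proof -
  have "support (root_valuation v \<theta>) = {f. F dvd f}"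
    unfolding support_def root_valuation_def w_eq_Top_iff irreducible_dvd_iff_root[OF assms(2,4)] ..
  then show ?thesis
    using assms by (simp add: abstract_key_polynomial_def)
qed

end

section \<open>Degrees along the frame, and the theorem\<close>

lemma strict_step_less:
  fixes m :: "nat \<Rightarrow> nat"
  assumes "\<And>i. i \<le> r \<Longrightarrow> m i < m (Suc i)" "l \<le> r"
  shows "m l < m (Suc r)"
  using assms(2)
proof (induction rule: inc_induct)
  case base
  then show ?case using assms(1) by simp
next
  case (step n)
  then show ?case using assms(1)[of n] by simp
qed

lemma ex_level:
  fixes m :: "nat \<Rightarrow> nat"
  assumes "m 0 \<le> d" "d < m (Suc r)"
  shows "\<exists>l\<le>r. m l \<le> d \<and> d < m (Suc l)"
  using assms(2)
proof (induction r)
  case (Suc r)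
  then show ?case
    by (cases "d < m (Suc r)") (auto intro: le_SucI)
qed (use assms(1) in auto)

theorem theorem4p8:
  fixes v :: "'a::field \<Rightarrow> 'g::linordered_ab_group_add top"
    and F :: "'a poly" and \<theta> :: "'a alg_closure" and \<Phi> :: "'a poly set list"
  assumes "henselian v"
    and "monic F" and "irreducible F" and "1 < degree F"
    and "poly (map_poly to_ac F) \<theta> = 0"
    and "okutsu_frame (root_valuation v \<theta>) F \<Phi>"
  shows "complete_set (root_valuation v \<theta>) (\<Union>(set \<Phi>))"
proof -
  interpret henselian_field v
    by unfold_locales fact
  let ?\<nu> = "root_valuation v \<theta>"
  obtain r m where len: "length \<Phi> = r + 2" and last: "\<Phi> ! (r + 1) = {F}"
    and members: "\<forall>l\<le>r + 1. \<forall>\<phi>\<in>\<Phi> ! l. monic \<phi> \<and> irreducible \<phi> \<and> degree \<phi> = m l"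
    and degrees: "m 0 = 1" "\<forall>l\<le>r. m l < m (l + 1)" "m (r + 1) = degree F"
    and bounds: "\<forall>l\<le>r. \<forall>g. monic g \<and> 0 < degree g \<and> degree g < m (l + 1) \<longrightarrow>
      (\<exists>\<phi>\<in>\<Phi> ! l. wt ?\<nu> g \<le> wt ?\<nu> \<phi>)"
    and steps: "\<forall>l\<le>r. \<forall>\<phi>\<in>\<Phi> ! l. \<forall>\<psi>\<in>\<Phi> ! (l + 1). wt ?\<nu> \<phi> < wt ?\<nu> \<psi>"
    using assms(6) unfolding okutsu_frame_def by (elim exE conjE) (rule that; assumption)
  have \<Phi>: "monic \<phi> \<and> irreducible \<phi> \<and> degree \<phi> = m l" if "l \<le> r + 1" "\<phi> \<in> \<Phi> ! l" for l \<phi>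
    using members that by blast
  have m: "m 0 = 1" "\<And>l. l \<le> r \<Longrightarrow> m l < m (Suc l)" "m (Suc r) = degree F"
    using degrees by simp_all
  have bound: "\<exists>\<phi>\<in>\<Phi> ! l. wt ?\<nu> g \<le> wt ?\<nu> \<phi>"
    if "l \<le> r" "monic g" "0 < degree g" "degree g < m (Suc l)" for l g
    using bounds that by simp
  have wt_step: "wt ?\<nu> \<phi> < wt ?\<nu> \<psi>" if "l \<le> r" "\<phi> \<in> \<Phi> ! l" "\<psi> \<in> \<Phi> ! Suc l" for l \<phi> \<psi>
    using steps that by simp
  have mem: "\<phi> \<in> \<Union>(set \<Phi>)" if "\<phi> \<in> \<Phi> ! l" "l \<le> r + 1" for \<phi> l
    using that len nth_mem[of l \<Phi>] by auto
  have center: "\<exists>\<alpha> \<delta>. key_center v \<theta> Q \<alpha> \<delta> \<and> (\<forall>h \<beta>. monic h \<longrightarrow> irreducible h \<longrightarrow> \<beta> \<in># roots h \<longrightarrow>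
      wt ?\<nu> h \<le> wt ?\<nu> Q \<longrightarrow> w (\<theta> - \<beta>) \<le> Value \<delta>)"
    if l: "l \<le> r" "Q \<in> \<Phi> ! l" for l Q
  proof -
    have Q: "monic Q" "irreducible Q" "degree Q = m l"
      using \<Phi>[of l Q] l by auto
    have "degree Q < degree F"
      using strict_step_less[of r m l] m(2,3) l(1) Q(3) by simp
    then have "\<not> F dvd Q"
      using dvd_imp_degree_le monic_nonzero[OF Q(1)] not_le by blast
    then have no_root: "poly (map_poly to_ac Q) \<theta> \<noteq> 0"
      using irreducible_dvd_iff_root[OF assms(3,5)] by blast
    have "wt ?\<nu> h < wt ?\<nu> Q" if h: "monic h" "0 < degree h" "degree h < degree Q" for h
    \<comment> \<open>At level 0 no positive degree lies below \<open>m 0 = 1\<close>. At level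
      \<open>k + 1\<close> a member of level \<open>k\<close> dominates \<open>h\<close>, and its
      weight is below that of \<open>Q\<close> by (OF3).\<close>
    proof (cases l)
      case 0
      then show ?thesis
        using h Q(3) m(1) by simp
    next
      case (Suc k)
      then obtain \<phi> where "\<phi> \<in> \<Phi> ! k" "wt ?\<nu> h \<le> wt ?\<nu> \<phi>"
        using bound[of k h] h Q(3) l(1) by auto
      then show ?thesis
        using wt_step[of k \<phi> Q] l Suc by (meson Suc_leD le_less_trans)
    qed
    then show ?thesis
      using ex_key_center[OF Q(1,2) no_root] by metis
  qed
  show ?thesis
    unfolding complete_set_def
  proof (intro conjI ballI allI impI)
    fix Q assume "Q \<in> \<Union>(set \<Phi>)"
    then obtain l where l: "l \<le> r + 1" "Q \<in> \<Phi> ! l"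
      using len by (auto simp: in_set_conv_nth less_Suc_eq_le)
    show "abstract_key_polynomial ?\<nu> Q"
    proof (cases "l \<le> r")
      case True
      then show ?thesis
        using center l key_center.abstract_key_polynomial_Q by blast
    next
      case False
      then have "Q = F"
        using l last by (simp add: le_Suc_eq)
      then show ?thesis
        using assms abstract_key_polynomial_minimal by simp
    qed
  next
    fix g :: "'a poly" assume g: "0 < degree g"
    show "\<exists>Q\<in>\<Union>(set \<Phi>). degree Q \<le> degree g \<and> truncation ?\<nu> Q g = ?\<nu> g"
    proof (cases "degree g < degree F")
      case False
      moreover have "F \<in> \<Union>(set \<Phi>)"
        using mem[of F "r + 1"] last by simp
      ultimately show ?thesis
        using truncation_eq_root_valuation[OF assms(5)] assms(4) by (intro bexI[of _ F]) auto
    next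
      case True
      then obtain l where l: "l \<le> r" "m l \<le> degree g" "degree g < m (Suc l)"
        using ex_level[of m "degree g" r] g m by auto
      have "g \<noteq> 0"
        using g by auto
      \<comment> \<open>For each root of \<open>g\<close>, \<open>h\<close> is its minimal
        polynomial and \<phi> a member of level \<open>l\<close> whose weight bounds that of
        \<open>h\<close>.\<close>
      have "\<exists>h \<phi>. monic h \<and> irreducible h \<and> \<beta> \<in># roots h \<and> \<phi> \<in> \<Phi> ! l \<and> wt ?\<nu> h \<le> wt ?\<nu> \<phi>"
        if "\<beta> \<in># roots g" for \<beta>
      proof -
        obtain h where h: "monic h" "irreducible h" "h dvd g" "\<beta> \<in># roots h"
          using minimal_polynomial_factor[OF \<open>g \<noteq> 0\<close> \<open>\<beta> \<in># roots g\<close>] by blast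
        have "degree h < m (Suc l)"
          using dvd_imp_degree_le[OF h(3) \<open>g \<noteq> 0\<close>] l(3) by simp
        moreover have "0 < degree h"
          using h(2) monic_nonzero[OF h(1)] by (metis gr0I irreducible_def is_unit_iff_degree)
        ultimately show ?thesis
          using bound[OF l(1) h(1)] h by blast
      qed
      then obtain h \<phi> where h: "\<And>\<beta>. \<beta> \<in># roots g \<Longrightarrow> monic (h \<beta>) \<and> irreducible (h \<beta>) \<and> \<beta> \<in># roots (h \<beta>) \<and>
          \<phi> \<beta> \<in> \<Phi> ! l \<and> wt ?\<nu> (h \<beta>) \<le> wt ?\<nu> (\<phi> \<beta>)"
        by metis
      \<comment> \<open>A level may have no member of largest weight, but only finitely many roots
        have to be controlled, so the chosen member of largest weight serves for all of
        them.\<close>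
      let ?W = "(\<lambda>\<beta>. wt ?\<nu> (\<phi> \<beta>)) ` set_mset (roots g)"
      have "roots g \<noteq> {#}"
        using map_poly_to_ac_factor(2)[OF \<open>g \<noteq> 0\<close>] g by auto
      then have "Max ?W \<in> ?W"
        by (intro Max_in) auto
      then obtain \<beta>\<^sub>0 where \<beta>\<^sub>0: "\<beta>\<^sub>0 \<in># roots g" "wt ?\<nu> (\<phi> \<beta>\<^sub>0) = Max ?W"
        by auto
      define Q where "Q = \<phi> \<beta>\<^sub>0"
      have max: "wt ?\<nu> (\<phi> \<beta>) \<le> wt ?\<nu> Q" if "\<beta> \<in># roots g" for \<beta>
        using that by (simp add: Q_def \<beta>\<^sub>0(2))
      have "Q \<in> \<Phi> ! l"
        using h[OF \<beta>\<^sub>0(1)] by (simp add: Q_def)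
      then obtain \<alpha> \<delta> where "key_center v \<theta> Q \<alpha> \<delta>"
        and close: "\<And>h \<beta>. monic h \<Longrightarrow> irreducible h \<Longrightarrow> \<beta> \<in># roots h \<Longrightarrow> wt ?\<nu> h \<le> wt ?\<nu> Q \<Longrightarrow>
          w (\<theta> - \<beta>) \<le> Value \<delta>"
        using center[OF l(1)] by blast
      interpret key_center v \<theta> Q \<alpha> \<delta>
        by fact
      have "w (\<theta> - \<beta>) \<le> Value \<delta>" if "\<beta> \<in># roots g" for \<beta>
        using close[of "h \<beta>" \<beta>] h[OF that] max[OF that] by (meson order_trans)
      then have "truncation ?\<nu> Q g = ?\<nu> g"
        using \<mu>_eq_\<nu>[OF \<open>g \<noteq> 0\<close>] by (simp add: truncation_eq_\<mu>)
      moreover have "degree Q \<le> degree g"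
        using \<Phi>[of l Q] \<open>Q \<in> \<Phi> ! l\<close> l by simp
      ultimately show ?thesis
        using mem[OF \<open>Q \<in> \<Phi> ! l\<close>] l(1) by auto
    qed
  qed
qed

end
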